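(* Suppose that $\Gamma$ is finite, that $H:\Gamma\rightsquigarrow\Gamma$ is a set-valued map and that $(x,\sigma)$ is a forward complete trajectory of $\dot x=f(x,\sigma)$ with $\sigma\in\mathcal{S}_d\cap\mathcal{S}^H$. Suppose in addition that $f_\gamma(0)=0$ for every $\gamma\in\Gamma$ such that $0\in\chi_\gamma$, and that for every $\gamma\in\Gamma$ such that $0\in\chi_\gamma$ the initial value problem $\dot x=f_\gamma(x)$, $x(0)=0$ has a unique solution. For $V\in\mathcal{V}$ and a family $\{W_\gamma:\mathcal{O}_\gamma\to\mathbb{R},\gamma\in\Gamma\}$ consider the conditions $(\ast)$ $-\nabla V_\gamma(\xi)f_\gamma(\xi)\ge W_\gamma(\xi)\ge0$ for all $\xi\in\mathcal{O}_\gamma$ and all $\gamma\in\Gamma$; (i) $\mathcal{O}_\gamma^f(f_\gamma,W_\gamma,\infty)\subset\{0\}$ for every $\gamma\in\Gamma$, or $\mathcal{O}_\gamma^b(f_\gamma,W_\gamma,\infty)\subset\{0\}$ for every $\gamma\in\Gamma$; (ii) for each simple cycle $\{\gamma_i\}_{i=1}^m$ of $H$ there exists $j\in\{1,\ldots,m-1\}$ such that $\mathcal{O}_{\gamma_j}^b(f_{\gamma_j},W_{\gamma_j})\cap\mathcal{O}_{\gamma_{j+1}}^f(f_{\gamma_{j+1}},W_{\gamma_{j+1}})\subset\{0\}$; (iii) for every $c\in\mathbb{R}$ and for each simple cycle $\{\gamma_i\}_{i=1}^m$ of $H$ there exists $j\in\{1,\ldots,m-1\}$ such that $\mathcal{O}_{\gamma_j}^b(f_{\gamma_j},W_{\gamma_j})\cap\mathcal{O}_{\gamma_{j+1}}^f(f_{\gamma_{j+1}},W_{\gamma_{j+1}})\cap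 V_{\gamma_j}^{-1}(c)\cap V_{\gamma_{j+1}}^{-1}(c)\subset\{0\}$. 1. Suppose there exist $V\in\mathcal{V}$ and a family $\{W_\gamma:\mathcal{O}_\gamma\to\mathbb{R},\gamma\in\Gamma\}$ such that $(x,\sigma)$ is precompact relative to $\mathcal{O}$, for every $\gamma\in\Gamma$ the function $v(t)=V(x(t),\sigma(t))$ is nonincreasing on $\sigma^{-1}(\gamma)\cap[0,+\infty)$, and $(\ast)$ holds; suppose also that $0\in\mathcal{O}$ and that (i) and (ii) hold. Then $x\to0$. 2. Suppose there exist $V\in\mathcal{V}$, whose restriction to $\mathrm{dom}(f)\cap(\mathcal{O}\times\Gamma)$ is continuous, and a family $\{W_\gamma:\mathcal{O}_\gamma\to\mathbb{R},\gamma\in\Gamma\}$ such that $(x,\sigma)$ is precompact relative to $\mathcal{O}$, $v(t)=V(x(t),\sigma(t))$ is nonincreasing on $[0,+\infty)$, and $(\ast)$ holds; suppose also that $0\in\mathcal{O}$ and that (i) and (iii) hold. Then $x\to0$.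
   Context: Setting: $\Gamma$ is a compact metric space (here finite), $\mathrm{dom}(f)\subset\mathbb{R}^n\times\Gamma$ is closed and $f:\mathrm{dom}(f)\to\mathbb{R}^n$ is continuous. For $\gamma\in\Gamma$, $\chi_\gamma=\{\xi\in\mathbb{R}^n:(\xi,\gamma)\in\mathrm{dom}(f)\}$ and $f_\gamma:\chi_\gamma\to\mathbb{R}^n$, $f_\gamma(\xi)=f(\xi,\gamma)$. A switching signal is a function $\sigma:\mathbb{R}\to\Gamma$ that is piecewise constant (at most finitely many jumps in each compact interval) and continuous from the right; $\Lambda(\sigma)$ is the set of times at which $\sigma$ has a jump. A solution of $\dot x=f(x,\sigma)$ corresponding to $\sigma$ is a locally absolutely continuous $x:I_x\to\mathbb{R}^n$, $I_x\subset\mathbb{R}$ a nonempty interval, with $(x(t),\sigma(t))\in\mathrm{dom}(f)$ for all $t\in I_x$ and $\dot x(t)=f(x(t),\sigma(t))$ for almost all $t\in I_x$. Then $(x,\sigma)$ is called a trajectory; it is forward complete if $\mathbb{R}_{\ge0}\subset I_x$. It is precompact relative to $\mathcal{O}\subset\mathbb{R}^n$ if there is a compact set $B\subset\mathcal{O}$ with $x(t)\in B$ for all $t\in I_x$. Uniqueness for $\dot x=f_\gamma(x)$, $x(0)=0$ means that any solution on an interval containing $0$ (forward and backward in time) coincides with the zero solution there. $\mathcal{S}_d=\bigcup_{\tau_D>0}\mathcal{S}_d[\tau_D]$, where $\mathcal{S}_d[\tau_D]$ is the set of switching signals with $|t-t'|\ge\tau_D$ for all $t\ne t'$ in $\Lambda(\sigma)$.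 For a set-valued map $H:\Gamma\rightsquigarrow\Gamma$, $\mathcal{S}^H$ is the set of switching signals $\sigma$ with $\sigma(t)\in H(\sigma(t^-))$ for every $t\in\Lambda(\sigma)$, where $\sigma(t^-)=\lim_{s\to t^-}\sigma(s)$. A finite sequence $\{\gamma_i\}_{i=1}^m\subset\Gamma$, $m\ge3$, is a simple cycle of $H$ if $\gamma_1=\gamma_m$, $\gamma_{i+1}\in H(\gamma_i)$ for all $i=1,\ldots,m-1$, and if $\gamma_i=\gamma_j$ and $i<j$ then $i=1$ and $j=m$. $x\to0$ means $\lim_{t\to+\infty}x(t)=0$. $\pi_1:\mathbb{R}^n\times\Gamma\to\mathbb{R}^n$ is the projection onto the first component. Class $\mathcal{V}$: $V:\mathrm{dom}(V)\to\mathbb{R}$ belongs to $\mathcal{V}$ if $\mathrm{dom}(V)\subset\mathbb{R}^n\times\Gamma$; for every $\gamma\in\Gamma$ the set $\mathcal{D}_\gamma=\{\xi:(\xi,\gamma)\in\mathrm{dom}(V)\}$ is open; with $\mathcal{O}=\pi_1(\mathrm{dom}(V))$ and $\mathcal{O}_\gamma=\mathcal{O}\cap\chi_\gamma$, one has $\mathcal{O}_\gamma\subset\mathcal{D}_\gamma$ for all $\gamma$; and for all $\gamma$, $V_\gamma(\cdot)=V(\cdot,\gamma)$ is differentiable on $\mathcal{O}_\gamma$. ($\mathcal{O}$ and $\mathcal{O}_\gamma$ always refer to the function $V$ under consideration.) Observability-like sets: given $\mathcal{X}\subset\mathbb{R}^n$, a continuous map $g:\mathcal{X}\to\mathbb{R}^n$,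 a function $h:\mathcal{X}\to\mathbb{R}$ and $\tau>0$ or $\tau=\infty$, $\mathcal{X}^f(g,h,\tau)$ (resp. $\mathcal{X}^b(g,h,\tau)$) is the set of $\xi\in\mathcal{X}$ for which there is a solution $\varphi:[0,\tau]\to\mathcal{X}$ (resp. $\varphi:[-\tau,0]\to\mathcal{X}$) of $\dot x=g(x)$ with $\varphi(0)=\xi$ and $h(\varphi(t))=0$ for all $t\in[0,\tau]$ (resp. $t\in[-\tau,0]$); for $\tau=\infty$ the intervals are $[0,\infty)$ and $(-\infty,0]$. Also $\mathcal{X}^f(g,h)=\bigcup_{\tau>0}\mathcal{X}^f(g,h,\tau)$ and $\mathcal{X}^b(g,h)=\bigcup_{\tau>0}\mathcal{X}^b(g,h,\tau)$. The sets $\mathcal{O}_\gamma^f(f_\gamma,W_\gamma)$, $\mathcal{O}_\gamma^b(f_\gamma,W_\gamma)$, $\mathcal{O}_\gamma^f(f_\gamma,W_\gamma,\infty)$, $\mathcal{O}_\gamma^b(f_\gamma,W_\gamma,\infty)$ are these sets with $\mathcal{X}=\mathcal{O}_\gamma$, $g=f_\gamma|_{\mathcal{O}_\gamma}$, $h=W_\gamma$. *)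

theory Defs
  imports "HOL-Analysis.Analysis"
begin

definition abs_continuous_on :: "real \<Rightarrow> real \<Rightarrow> (real \<Rightarrow> 'a::real_normed_vector) \<Rightarrow> bool" where
  "abs_continuous_on a b x \<longleftrightarrow>
     (\<forall>\<epsilon>>0. \<exists>\<delta>>0. \<forall>(n::nat) u v.
        (\<forall>i<n. u i \<le> v i \<and> {u i..v i} \<subseteq> {a..b}) \<longrightarrow>
        (\<forall>i<n. \<forall>j<n. i \<noteq> j \<longrightarrow> {u i<..<v i} \<inter> {u j<..<v j} = {}) \<longrightarrow>
        (\<Sum>i<n. v i - u i) < \<delta> \<longrightarrow>
        (\<Sum>i<n. norm (x (v i) - x (u i))) < \<epsilon>)"

definition locally_abs_continuous_on :: "real set \<Rightarrow> (real \<Rightarrow> 'a::real_normed_vector) \<Rightarrow> bool" where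
  "locally_abs_continuous_on I x \<longleftrightarrow> (\<forall>a b. a \<le> b \<and> {a..b} \<subseteq> I \<longrightarrow> abs_continuous_on a b x)"

text \<open>Solutions on \<open>I\<close> of a nonautonomous equation whose state at time \<open>t\<close> is constrained to
  \<open>D t\<close> and whose right-hand side at time \<open>t\<close> is \<open>F t\<close>. It is used both for the switched system
  and, with \<open>D\<close> and \<open>F\<close> constant in time, for the autonomous equations.\<close>

definition is_solution ::
  "(real \<Rightarrow> 'a::euclidean_space set) \<Rightarrow> (real \<Rightarrow> 'a \<Rightarrow> 'a) \<Rightarrow> real set \<Rightarrow> (real \<Rightarrow> 'a) \<Rightarrow> bool" where
  "is_solution D F I x \<longleftrightarrow>
     is_interval I \<and> I \<noteq> {} \<and> locally_abs_continuous_on I x \<and>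
     (\<forall>t\<in>I. x t \<in> D t) \<and>
     (AE t in lebesgue. t \<in> I \<longrightarrow> (x has_vector_derivative F t (x t)) (at t within I))"

abbreviation is_autonomous_solution ::
  "'a::euclidean_space set \<Rightarrow> ('a \<Rightarrow> 'a) \<Rightarrow> real set \<Rightarrow> (real \<Rightarrow> 'a) \<Rightarrow> bool" where
  "is_autonomous_solution X g I x \<equiv> is_solution (\<lambda>_. X) (\<lambda>_. g) I x"

definition unique_zero_solution :: "'a::euclidean_space set \<Rightarrow> ('a \<Rightarrow> 'a) \<Rightarrow> bool" where
  "unique_zero_solution X g \<longleftrightarrow>
     (\<forall>I \<phi>. is_autonomous_solution X g I \<phi> \<and> 0 \<in> I \<and> \<phi> 0 = 0 \<longrightarrow> (\<forall>t\<in>I. \<phi> t = 0))"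

definition jumps :: "(real \<Rightarrow> 'g::metric_space) \<Rightarrow> real set" where
  "jumps \<sigma> = {t. \<not> isCont \<sigma> t}"

text \<open>"Piecewise constant" means finitely many jumps in each compact interval and constant on every
  interval without jumps; the second part is not automatic if \<open>\<Gamma>\<close> is infinite.\<close>

definition switching_signal :: "'g::metric_space set \<Rightarrow> (real \<Rightarrow> 'g) \<Rightarrow> bool" where
  "switching_signal \<Gamma> \<sigma> \<longleftrightarrow>
     range \<sigma> \<subseteq> \<Gamma> \<and>
     (\<forall>a b. finite (jumps \<sigma> \<inter> {a..b})) \<and>
     (\<forall>s t. s \<le> t \<and> {s..t} \<inter> jumps \<sigma> = {} \<longrightarrow> \<sigma> s = \<sigma> t) \<and>
     (\<forall>t. continuous (at_right t) \<sigma>)"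

definition signals_with_dwell :: "'g::metric_space set \<Rightarrow> real \<Rightarrow> (real \<Rightarrow> 'g) set" where
  "signals_with_dwell \<Gamma> \<tau> =
     {\<sigma>. switching_signal \<Gamma> \<sigma> \<and> (\<forall>t\<in>jumps \<sigma>. \<forall>t'\<in>jumps \<sigma>. t \<noteq> t' \<longrightarrow> \<bar>t - t'\<bar> \<ge> \<tau>)}"

definition dwell_signals :: "'g::metric_space set \<Rightarrow> (real \<Rightarrow> 'g) set" where
  "dwell_signals \<Gamma> = (\<Union>\<tau>\<in>{0<..}. signals_with_dwell \<Gamma> \<tau>)"

definition signals_compatible :: "'g::metric_space set \<Rightarrow> ('g \<Rightarrow> 'g set) \<Rightarrow> (real \<Rightarrow> 'g) set" where
  "signals_compatible \<Gamma> H =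
     {\<sigma>. switching_signal \<Gamma> \<sigma> \<and> (\<forall>t\<in>jumps \<sigma>. \<sigma> t \<in> H (Lim (at_left t) \<sigma>))}"

text \<open>A finite sequence is given by its length \<open>m\<close> and its values \<open>c 1, \<dots>, c m\<close>; the values of
  \<open>c\<close> at other indices are irrelevant.\<close>

definition simple_cycle :: "'g set \<Rightarrow> ('g \<Rightarrow> 'g set) \<Rightarrow> nat \<Rightarrow> (nat \<Rightarrow> 'g) \<Rightarrow> bool" where
  "simple_cycle \<Gamma> H m c \<longleftrightarrow>
     m \<ge> 3 \<and> (\<forall>i\<in>{1..m}. c i \<in> \<Gamma>) \<and> c 1 = c m \<and>
     (\<forall>i\<in>{1..m-1}. c (i + 1) \<in> H (c i)) \<and>
     (\<forall>i\<in>{1..m}. \<forall>j\<in>{1..m}. c i = c j \<and> i < j \<longrightarrow> i = 1 \<and> j = m)"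

definition slice :: "('a \<times> 'g) set \<Rightarrow> 'g \<Rightarrow> 'a set" where
  "slice D \<gamma> = {\<xi>. (\<xi>, \<gamma>) \<in> D}"

definition trajectory ::
  "'g::metric_space set \<Rightarrow> ('a::euclidean_space \<times> 'g) set \<Rightarrow> ('a \<times> 'g \<Rightarrow> 'a) \<Rightarrow>
   real set \<Rightarrow> (real \<Rightarrow> 'a) \<Rightarrow> (real \<Rightarrow> 'g) \<Rightarrow> bool" where
  "trajectory \<Gamma> domf f I x \<sigma> \<longleftrightarrow>
     switching_signal \<Gamma> \<sigma> \<and>
     is_solution (\<lambda>t. slice domf (\<sigma> t)) (\<lambda>t \<xi>. f (\<xi>, \<sigma> t)) I x"

definition forward_complete :: "real set \<Rightarrow> bool" where
  "forward_complete I \<longleftrightarrow> {0..} \<subseteq> I"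

definition precompact_relative :: "real set \<Rightarrow> (real \<Rightarrow> 'a::euclidean_space) \<Rightarrow> 'a set \<Rightarrow> bool" where
  "precompact_relative I x U \<longleftrightarrow> (\<exists>B. compact B \<and> B \<subseteq> U \<and> (\<forall>t\<in>I. x t \<in> B))"

text \<open>A function \<open>V\<close> with domain \<open>domV\<close> is a total function together with the set \<open>domV\<close>; the sets
  \<open>O\<close> and \<open>O\<^sub>\<gamma>\<close> are \<open>proj_dom domV\<close> and \<open>proj_slice domf domV \<gamma>\<close>.\<close>

definition proj_dom :: "('a \<times> 'g) set \<Rightarrow> 'a set" where
  "proj_dom domV = fst ` domV"

definition proj_slice :: "('a \<times> 'g) set \<Rightarrow> ('a \<times> 'g) set \<Rightarrow> 'g \<Rightarrow> 'a set" where
  "proj_slice domf domV \<gamma> = proj_dom domV \<inter> slice domf \<gamma>"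

text \<open>Differentiability and the gradient are taken at points of \<open>O\<^sub>\<gamma>\<close>, which lie in the open set
  \<open>slice domV \<gamma>\<close>, so the values of \<open>V\<close> outside \<open>domV\<close> play no role.\<close>

definition class_V ::
  "'g set \<Rightarrow> ('a::euclidean_space \<times> 'g) set \<Rightarrow> ('a \<times> 'g) set \<Rightarrow> ('a \<times> 'g \<Rightarrow> real) \<Rightarrow> bool" where
  "class_V \<Gamma> domf domV V \<longleftrightarrow>
     domV \<subseteq> UNIV \<times> \<Gamma> \<and>
     (\<forall>\<gamma>\<in>\<Gamma>. open (slice domV \<gamma>)) \<and>
     (\<forall>\<gamma>\<in>\<Gamma>. proj_slice domf domV \<gamma> \<subseteq> slice domV \<gamma>) \<and>
     (\<forall>\<gamma>\<in>\<Gamma>. \<forall>\<xi>\<in>proj_slice domf domV \<gamma>. (\<lambda>\<eta>. V (\<eta>, \<gamma>)) differentiable (at \<xi>))"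

definition gradient :: "('a::euclidean_space \<Rightarrow> real) \<Rightarrow> 'a \<Rightarrow> 'a" where
  "gradient U \<xi> = (THE D. GDERIV U \<xi> :> D)"

definition dissipation ::
  "'g set \<Rightarrow> ('a::euclidean_space \<times> 'g) set \<Rightarrow> ('a \<times> 'g \<Rightarrow> 'a) \<Rightarrow>
   ('a \<times> 'g) set \<Rightarrow> ('a \<times> 'g \<Rightarrow> real) \<Rightarrow> ('g \<Rightarrow> 'a \<Rightarrow> real) \<Rightarrow> bool" where
  "dissipation \<Gamma> domf f domV V W \<longleftrightarrow>
     (\<forall>\<gamma>\<in>\<Gamma>. \<forall>\<xi>\<in>proj_slice domf domV \<gamma>.
        - (gradient (\<lambda>\<eta>. V (\<eta>, \<gamma>)) \<xi> \<bullet> f (\<xi>, \<gamma>)) \<ge> W \<gamma> \<xi> \<and> W \<gamma> \<xi> \<ge> 0)"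

text \<open>The horizon \<open>\<tau>\<close> is an extended real: \<open>\<tau> = \<infinity>\<close> gives the intervals \<open>[0, \<infinity>)\<close> and \<open>(-\<infinity>, 0]\<close>.\<close>

definition obs_fwd_upto ::
  "'a::euclidean_space set \<Rightarrow> ('a \<Rightarrow> 'a) \<Rightarrow> ('a \<Rightarrow> real) \<Rightarrow> ereal \<Rightarrow> 'a set" where
  "obs_fwd_upto X g h \<tau> =
     {\<xi>\<in>X. \<exists>\<phi>. is_autonomous_solution X g {t. 0 \<le> t \<and> ereal t \<le> \<tau>} \<phi> \<and> \<phi> 0 = \<xi> \<and>
                (\<forall>t. 0 \<le> t \<and> ereal t \<le> \<tau> \<longrightarrow> h (\<phi> t) = 0)}"

definition obs_bwd_upto ::
  "'a::euclidean_space set \<Rightarrow> ('a \<Rightarrow> 'a) \<Rightarrow> ('a \<Rightarrow> real) \<Rightarrow> ereal \<Rightarrow> 'a set" where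
  "obs_bwd_upto X g h \<tau> =
     {\<xi>\<in>X. \<exists>\<phi>. is_autonomous_solution X g {t. - \<tau> \<le> ereal t \<and> t \<le> 0} \<phi> \<and> \<phi> 0 = \<xi> \<and>
                (\<forall>t. - \<tau> \<le> ereal t \<and> t \<le> 0 \<longrightarrow> h (\<phi> t) = 0)}"

definition obs_fwd :: "'a::euclidean_space set \<Rightarrow> ('a \<Rightarrow> 'a) \<Rightarrow> ('a \<Rightarrow> real) \<Rightarrow> 'a set" where
  "obs_fwd X g h = (\<Union>\<tau>\<in>{0::real<..}. obs_fwd_upto X g h (ereal \<tau>))"

definition obs_bwd :: "'a::euclidean_space set \<Rightarrow> ('a \<Rightarrow> 'a) \<Rightarrow> ('a \<Rightarrow> real) \<Rightarrow> 'a set" where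
  "obs_bwd X g h = (\<Union>\<tau>\<in>{0::real<..}. obs_bwd_upto X g h (ereal \<tau>))"

end

theory Submission
  imports Defs "HOL-Library.Diagonal_Subsequence"
begin

text \<open>If \<open>x\<close> does not tend to \<open>0\<close>, choose \<open>s k \<longlonglongrightarrow> \<infinity>\<close> with \<open>x (s k)\<close> bounded away from \<open>0\<close>. By the Lipschitz
  bound and the dwell time, a subsequence of the translates of \<open>(x, \<sigma>)\<close> by \<open>s k\<close> converges to a trajectory
  \<open>(y, \<sigma>*)\<close> defined on all of \<open>\<real>\<close>. Along it \<open>V\<^sub>\<gamma>\<close> equals the limit \<open>C \<gamma>\<close> of \<open>V\<^sub>\<gamma> (x t)\<close> over the times with
  \<open>\<sigma> t = \<gamma>\<close>, so \<open>V\<^sub>\<gamma> \<circ> y\<close> has zero derivative and \<open>W\<^sub>\<gamma>\<close> vanishes. If the switches of \<open>\<sigma>*\<close> contain a simple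
  cycle of \<open>H\<close>, the cycle condition makes \<open>y\<close> vanish at a switching time; otherwise \<open>\<sigma>*\<close> is eventually
  constant in both directions of time, and condition (i) makes \<open>y\<close> vanish somewhere. By uniqueness
  \<open>y\<close> is identically \<open>0\<close>, which contradicts the choice of \<open>s\<close>.\<close>

section \<open>Absolutely continuous functions\<close>

text \<open>\<open>W\<close> need not be continuous, so its vanishing cannot be obtained by letting
  \<open>k\<close> tend to infinity. What passes to the limit are the values of \<open>V\<close> and
  the integral form of the differential equation; along the limit, 0 = -grad V . f >= W >= 0 then
  holds at every point. This needs a derivative of \<open>y\<close> at every time, whereas solutions
  are differentiable only almost everywhere. Hence the detour: an integral equation for
  \<open>x\<close> by the fundamental theorem of calculus for absolutely continuous functions, its
  limit by dominated convergence, and derivatives of \<open>y\<close> back from the continuity of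
  the right-hand side. Both parts are instances of one statement with a level
  \<open>C \<gamma>\<close> for each mode: the levels may differ in part 1 and coincide in part 2,
  which is what (iii) exploits. The limit is taken in both directions of time because (i) may
  concern backward solutions, and because (ii) and (iii) combine the past and the future of a
  switch.\<close>

lemma abs_continuous_on_finite_family:
  fixes x :: "real \<Rightarrow> 'a::real_normed_vector"
  assumes "abs_continuous_on a b x" and "\<epsilon> > 0"
  shows "\<exists>\<delta>>0. \<forall>(A :: 'j set) u v. finite A \<longrightarrow> (\<forall>j\<in>A. u j \<le> v j \<and> {u j..v j} \<subseteq> {a..b}) \<longrightarrow>
      (\<forall>j\<in>A. \<forall>k\<in>A. j \<noteq> k \<longrightarrow> {u j<..<v j} \<inter> {u k<..<v k} = {}) \<longrightarrow>
      (\<Sum>j\<in>A. v j - u j) < \<delta> \<longrightarrow> (\<Sum>j\<in>A. norm (x (v j) - x (u j))) < \<epsilon>"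
proof -
  obtain \<delta> where "\<delta> > 0" and
    \<delta>: "\<forall>(n::nat) u v. (\<forall>i<n. u i \<le> v i \<and> {u i..v i} \<subseteq> {a..b}) \<longrightarrow>
        (\<forall>i<n. \<forall>j<n. i \<noteq> j \<longrightarrow> {u i<..<v i} \<inter> {u j<..<v j} = {}) \<longrightarrow>
        (\<Sum>i<n. v i - u i) < \<delta> \<longrightarrow> (\<Sum>i<n. norm (x (v i) - x (u i))) < \<epsilon>"
    using assms(1)[unfolded abs_continuous_on_def, rule_format, OF assms(2)] by (elim exE conjE)
  show ?thesis
  proof (intro exI[of _ \<delta>] conjI allI impI)
    fix A :: "'j set" and u v
    assume A: "finite A" "\<forall>j\<in>A. u j \<le> v j \<and> {u j..v j} \<subseteq> {a..b}"
      "\<forall>j\<in>A. \<forall>k\<in>A. j \<noteq> k \<longrightarrow> {u j<..<v j} \<inter> {u k<..<v k} = {}"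
      "(\<Sum>j\<in>A. v j - u j) < \<delta>"
    \<comment> \<open>The definition speaks of families indexed by an initial segment of the
      naturals; enumerating \<open>A\<close> makes it applicable to the tagged intervals of a
      division, which serve as their own indices.\<close>
    obtain h where h: "bij_betw h {..<card A} A"
      using ex_bij_betw_nat_finite[OF A(1)] by (auto simp: atLeast0LessThan)
    have inA: "h i \<in> A" if "i < card A" for i
      using h that by (auto simp: bij_betw_def)
    have inj: "h i \<noteq> h j" if "i < card A" "j < card A" "i \<noteq> j" for i j
      using h that by (auto simp: bij_betw_def inj_on_def)
    note \<delta>h = \<delta>[THEN spec[of _ "card A"], THEN spec[of _ "\<lambda>i. u (h i)"], THEN spec[of _ "\<lambda>i. v (h i)"]]
    have "\<forall>i<card A. u (h i) \<le> v (h i) \<and> {u (h i)..v (h i)} \<subseteq> {a..b}"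
      using A(2) inA by blast
    moreover have "\<forall>i<card A. \<forall>j<card A. i \<noteq> j \<longrightarrow> {u (h i)<..<v (h i)} \<inter> {u (h j)<..<v (h j)} = {}"
      using A(3) inA inj by blast
    moreover have "(\<Sum>i<card A. v (h i) - u (h i)) < \<delta>"
      using A(4) by (simp only: sum.reindex_bij_betw[OF h, of "\<lambda>j. v j - u j"])
    ultimately have "(\<Sum>i<card A. norm (x (v (h i)) - x (u (h i)))) < \<epsilon>"
      using \<delta>h by iprover
    then show "(\<Sum>j\<in>A. norm (x (v j) - x (u j))) < \<epsilon>"
      by (simp only: sum.reindex_bij_betw[OF h, of "\<lambda>j. norm (x (v j) - x (u j))"])
  qed (use \<open>\<delta> > 0\<close> in auto)
qed

text \<open>Splitting the increment over \<open>{u..v}\<close> at the tag \<open>t\<close> gives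
  errors \<open>\<epsilon> * (t - u)\<close> and \<open>\<epsilon> * (v - t)\<close>, whose sum
  carries no extra factor. This is the error that one tagged interval contributes to a Riemann
  sum.\<close>

lemma has_vector_derivative_straddle:
  fixes x :: "real \<Rightarrow> 'a::real_normed_vector"
  assumes "(x has_vector_derivative D) (at t within S)" and "\<epsilon> > 0"
  obtains r where "r > 0"
    "\<And>u v. \<lbrakk>u \<in> S; v \<in> S; u \<le> t; t \<le> v; t - u < r; v - t < r\<rbrakk>
       \<Longrightarrow> norm ((v - u) *\<^sub>R D - (x v - x u)) \<le> \<epsilon> * (v - u)"
proof -
  obtain r where "r > 0" and
    r: "\<And>y. y \<in> S \<Longrightarrow> \<bar>y - t\<bar> < r \<Longrightarrow> norm (x y - x t - (y - t) *\<^sub>R D) \<le> \<epsilon> * \<bar>y - t\<bar>"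
    using assms unfolding has_vector_derivative_def has_derivative_within_alt by fastforce
  show ?thesis
  proof (rule that[OF \<open>r > 0\<close>])
    fix u v assume uv: "u \<in> S" "v \<in> S" "u \<le> t" "t \<le> v" "t - u < r" "v - t < r"
    have "(v - u) *\<^sub>R D - (x v - x u) =
        (x u - x t - (u - t) *\<^sub>R D) - (x v - x t - (v - t) *\<^sub>R D)"
      by (simp add: algebra_simps)
    also have "norm \<dots> \<le> norm (x u - x t - (u - t) *\<^sub>R D) + norm (x v - x t - (v - t) *\<^sub>R D)"
      by (rule norm_triangle_ineq4)
    also have "\<dots> \<le> \<epsilon> * \<bar>u - t\<bar> + \<epsilon> * \<bar>v - t\<bar>"
      using uv by (intro add_mono r) auto
    also have "\<dots> = \<epsilon> * (v - u)"
      using uv by (simp add: algebra_simps)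
    finally show "norm ((v - u) *\<^sub>R D - (x v - x u)) \<le> \<epsilon> * (v - u)" .
  qed
qed

lemma negligible_open_superset:
  fixes N :: "'a::euclidean_space set"
  assumes "negligible N" and "\<epsilon> > 0"
  obtains U where "open U" "N \<subseteq> U" "U \<in> lmeasurable" "measure lebesgue U < \<epsilon>"
proof -
  have N: "N \<in> null_sets lebesgue" using assms(1) by (simp add: negligible_iff_null_sets)
  obtain U where U: "open U" "N \<subseteq> U" "U - N \<in> lmeasurable" "emeasure lebesgue (U - N) < ennreal \<epsilon>"
    using sets_lebesgue_outer_open[OF negligible_imp_sets[OF assms(1)] assms(2)] .
  have "emeasure lebesgue U = emeasure lebesgue (U - N)"
    using U(1) N by (intro emeasure_Diff_null_set[symmetric]) auto
  with U(4) have U': "emeasure lebesgue U < ennreal \<epsilon>" by simp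
  have "U \<in> lmeasurable"
    using U(1) U' by (intro fmeasurableI) (auto intro: less_trans)
  moreover from this U' have "measure lebesgue U < \<epsilon>"
    using assms(2) by (simp add: emeasure_eq_measure2 ennreal_less_iff)
  ultimately show ?thesis
    using U that by blast
qed

text \<open>Tags in the null set where the derivative fails are handled by absolute continuity: their
  intervals lie in an open set of small measure.\<close>

lemma abs_continuous_on_has_integral:
  fixes x F :: "real \<Rightarrow> 'a::euclidean_space"
  assumes ac: "abs_continuous_on a b x" and "a \<le> b"
    and ae: "AE t in lebesgue. t \<in> {a..b} \<longrightarrow> (x has_vector_derivative F t) (at t within {a..b})"
  shows "(F has_integral (x b - x a)) {a..b}"
proof -
  obtain N0 where N0: "N0 \<in> null_sets lebesgue"
    and good0: "\<And>t. t \<notin> N0 \<Longrightarrow> t \<in> {a..b} \<Longrightarrow> (x has_vector_derivative F t) (at t within {a..b})"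
    using AE_E3[OF ae] by auto
  define N where "N = N0 \<inter> {a..b}"
  have "negligible N"
    using N0 negligible_subset[of N0 N] by (auto simp: negligible_iff_null_sets N_def)
  have good: "(x has_vector_derivative F t) (at t within {a..b})" if "t \<in> {a..b}" "t \<notin> N" for t
    using good0 that by (auto simp: N_def)
  \<comment> \<open>With the value 0 at the bad tags, an interval tagged in \<open>N\<close>
    contributes just an increment of \<open>x\<close>, which absolute continuity controls.\<close>
  define F' where "F' t = (if t \<in> N then 0 else F t)" for t
  have "(F' has_integral (x b - x a)) {a..b}"
    unfolding has_integral_real
  proof (intro allI impI)
    fix e :: real assume "e > 0"
    \<comment> \<open>The good intervals may use up \<open>e / 2\<close> in total; the summand 1
      keeps the denominator positive when \<open>a = b\<close>.\<close>
    define \<epsilon> where "\<epsilon> = e / (2 * (b - a + 1))"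
    have "\<epsilon> > 0" using \<open>e > 0\<close> \<open>a \<le> b\<close> by (auto simp: \<epsilon>_def)
    have \<epsilon>: "\<epsilon> * (b - a) \<le> e / 2"
      using \<open>e > 0\<close> \<open>a \<le> b\<close> by (simp add: \<epsilon>_def field_simps)
    obtain \<delta> where "\<delta> > 0" and
      \<delta>: "\<forall>(A :: (real \<times> real set) set) u v. finite A \<longrightarrow> (\<forall>j\<in>A. u j \<le> v j \<and> {u j..v j} \<subseteq> {a..b}) \<longrightarrow>
        (\<forall>j\<in>A. \<forall>k\<in>A. j \<noteq> k \<longrightarrow> {u j<..<v j} \<inter> {u k<..<v k} = {}) \<longrightarrow>
        (\<Sum>j\<in>A. v j - u j) < \<delta> \<longrightarrow> (\<Sum>j\<in>A. norm (x (v j) - x (u j))) < e/2"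
      using abs_continuous_on_finite_family[OF ac half_gt_zero[OF \<open>e > 0\<close>]] by (elim exE conjE)
    obtain U where U: "open U" "N \<subseteq> U" "U \<in> lmeasurable" "measure lebesgue U < \<delta>"
      using negligible_open_superset[OF \<open>negligible N\<close> \<open>\<delta> > 0\<close>] .
    \<comment> \<open>Positivity is part of \<open>Q\<close> and the estimate is void outside
      \<open>{a..b} - N\<close>, so that a single choice provides a radius at every real
      \<open>t\<close>.\<close>
    define Q where "Q t \<rho> \<longleftrightarrow> \<rho> > 0 \<and> (t \<in> {a..b} - N \<longrightarrow> (\<forall>u\<in>{a..b}. \<forall>v\<in>{a..b}. u \<le> t \<longrightarrow> t \<le> v \<longrightarrow>
        t - u < \<rho> \<longrightarrow> v - t < \<rho> \<longrightarrow> norm ((v - u) *\<^sub>R F t - (x v - x u)) \<le> \<epsilon> * (v - u)))" for t \<rho>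
    have exQ: "\<exists>\<rho>. Q t \<rho>" for t
    proof (cases "t \<in> {a..b} - N")
      case True
      then show ?thesis
        using has_vector_derivative_straddle[OF good \<open>\<epsilon> > 0\<close>, of t] unfolding Q_def by (metis Diff_iff)
    qed (auto simp: Q_def intro: exI[of _ 1])
    define r where "r t = (SOME \<rho>. Q t \<rho>)" for t
    have Qr: "Q t (r t)" for t
      unfolding r_def by (rule someI_ex[OF exQ])
    have r0: "r t > 0" and
      r: "\<lbrakk>t \<in> {a..b} - N; u \<in> {a..b}; v \<in> {a..b}; u \<le> t; t \<le> v; t - u < r t; v - t < r t\<rbrakk>
        \<Longrightarrow> norm ((v - u) *\<^sub>R F t - (x v - x u)) \<le> \<epsilon> * (v - u)" for t u v
      using Qr[of t] unfolding Q_def by simp_all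
    define g where "g t = (if t \<in> N then U else ball t (r t))" for t
    have "gauge g"
      using U r0 by (auto simp: gauge_def g_def)
    have "norm ((\<Sum>(t,K)\<in>p. measure lborel K *\<^sub>R F' t) - (x b - x a)) < e"
      if p: "p tagged_division_of {a..b}" "g fine p" for p
    proof -
      note pD = tagged_division_ofD[OF p(1)]
      have K: "\<exists>u v. j = (fst j, {u..v}) \<and> u \<le> v \<and> Inf (snd j) = u \<and> Sup (snd j) = v \<and>
          a \<le> u \<and> v \<le> b \<and> u \<le> fst j \<and> fst j \<le> v \<and> measure lborel (snd j) = v - u \<and> {u..v} \<subseteq> g (fst j)"
        if jp: "j \<in> p" for j
      proof -
        obtain t K where j: "j = (t, K)" by force
        obtain u v where uv: "K = {u..v}"
          using pD(4)[of t K] jp unfolding j box_real by blast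
        moreover have "t \<in> K" "K \<subseteq> {a..b}" "K \<subseteq> g t"
          using pD(2,3)[of t K] p(2) jp j by (auto simp: fine_def)
        ultimately show ?thesis using j by auto
      qed
      define B where "B = p \<inter> {j. fst j \<in> N}"
      define \<Phi> where "\<Phi> j = measure lborel (snd j) *\<^sub>R F' (fst j) - (x (Sup (snd j)) - x (Inf (snd j)))" for j
      have fin: "finite p" "finite B" using pD(1) by (auto simp: B_def)
      \<comment> \<open>The increments of \<open>x\<close> telescope over the division, so the total
        error is the sum of the errors \<open>\<Phi> j\<close> of the single intervals.\<close>
      have "(\<Sum>(t,K)\<in>p. measure lborel K *\<^sub>R F' t) - (x b - x a) = (\<Sum>j\<in>p. \<Phi> j)"
        unfolding additive_tagged_division_1[OF \<open>a \<le> b\<close> p(1), of x, symmetric] \<Phi>_def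
        by (simp add: sum_subtractf split_beta)
      also have "\<dots> = (\<Sum>j\<in>p - B. \<Phi> j) + (\<Sum>j\<in>B. \<Phi> j)"
        using fin by (intro sum.subset_diff) (auto simp: B_def)
      also have "norm \<dots> \<le> (\<Sum>j\<in>p - B. norm (\<Phi> j)) + (\<Sum>j\<in>B. norm (\<Phi> j))"
        by (intro norm_triangle_le add_mono norm_sum)
      also have "(\<Sum>j\<in>p - B. norm (\<Phi> j)) \<le> (\<Sum>j\<in>p - B. \<epsilon> * (Sup (snd j) - Inf (snd j)))"
      proof (rule sum_mono)
        fix j assume j: "j \<in> p - B"
        then obtain u v where *: "j = (fst j, {u..v})" "u \<le> v" "Inf (snd j) = u" "Sup (snd j) = v"
          "a \<le> u" "v \<le> b" "u \<le> fst j" "fst j \<le> v" "measure lborel (snd j) = v - u" "{u..v} \<subseteq> g (fst j)"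
          using K[of j] by auto
        have "fst j \<notin> N" using j by (auto simp: B_def)
        moreover have "u \<in> g (fst j)" "v \<in> g (fst j)" using * by auto
        ultimately show "norm (\<Phi> j) \<le> \<epsilon> * (Sup (snd j) - Inf (snd j))"
          using * r[of "fst j" u v] by (auto simp: \<Phi>_def F'_def g_def dist_real_def)
      qed
      also have "\<dots> \<le> (\<Sum>j\<in>p. \<epsilon> * (Sup (snd j) - Inf (snd j)))"
      proof (rule sum_mono2[OF fin(1)])
        fix j assume "j \<in> p - (p - B)"
        then show "0 \<le> \<epsilon> * (Sup (snd j) - Inf (snd j))"
          using K[of j] \<open>\<epsilon> > 0\<close> by force
      qed auto
      also have "\<dots> = \<epsilon> * (b - a)"
        using additive_tagged_division_1[OF \<open>a \<le> b\<close> p(1), of "\<lambda>x. x"]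
        by (simp add: sum_distrib_left[symmetric] split_beta)
      also have "(\<Sum>j\<in>B. norm (\<Phi> j)) = (\<Sum>j\<in>B. norm (x (Sup (snd j)) - x (Inf (snd j))))"
        by (intro sum.cong refl) (auto simp: \<Phi>_def F'_def B_def norm_minus_commute)
      also have "\<dots> < e / 2"
      proof (rule \<delta>[rule_format, OF fin(2)])
        fix j assume "j \<in> B"
        then show "Inf (snd j) \<le> Sup (snd j) \<and> {Inf (snd j)..Sup (snd j)} \<subseteq> {a..b}"
          using K[of j] by (auto simp: B_def)
      next
        have int: "{Inf (snd j)<..<Sup (snd j)} = interior (snd j)" if "j \<in> p" for j
          using K[OF that] by (metis interior_atLeastAtMost_real snd_conv)
        show disj: "{Inf (snd j)<..<Sup (snd j)} \<inter> {Inf (snd k)<..<Sup (snd k)} = {}"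
          if "j \<in> B" "k \<in> B" "j \<noteq> k" for j k
          using that pD(5)[of "fst j" "snd j" "fst k" "snd k"] by (auto simp: B_def int prod_eq_iff)
        \<comment> \<open>The open intervals are disjoint subsets of \<open>U\<close>, so their
          total length is at most the measure of \<open>U\<close>.\<close>
        have "(\<Sum>j\<in>B. Sup (snd j) - Inf (snd j))
            = (\<Sum>j\<in>B. measure lebesgue {Inf (snd j)<..<Sup (snd j)})"
        proof (rule sum.cong[OF refl])
          fix j assume "j \<in> B"
          then obtain u v where "u \<le> v" "Inf (snd j) = u" "Sup (snd j) = v"
            using K[of j] by (auto simp: B_def)
          then show "Sup (snd j) - Inf (snd j) = measure lebesgue {Inf (snd j)<..<Sup (snd j)}"
            by simp
        qed
        also have "\<dots> = measure lebesgue (\<Union>j\<in>B. {Inf (snd j)<..<Sup (snd j)})"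
          using disj by (intro measure_UNION'[symmetric] fin(2)) (auto simp: pairwise_def disjnt_def)
        also have "\<dots> \<le> measure lebesgue U"
        proof (rule measure_mono_fmeasurable[OF _ _ U(3)])
          show "(\<Union>j\<in>B. {Inf (snd j)<..<Sup (snd j)}) \<subseteq> U"
          proof (intro UN_least)
            fix j assume "j \<in> B"
            then obtain u v where "Inf (snd j) = u" "Sup (snd j) = v" "{u..v} \<subseteq> g (fst j)" "fst j \<in> N"
              using K[of j] by (auto simp: B_def)
            then show "{Inf (snd j)<..<Sup (snd j)} \<subseteq> U"
              by (auto simp: g_def)
          qed
        qed (use fin in auto)
        finally show "(\<Sum>j\<in>B. Sup (snd j) - Inf (snd j)) < \<delta>" using U by simp
      qed
      finally show ?thesis using \<epsilon> by simp
    qed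
    with \<open>gauge g\<close> show "\<exists>\<gamma>. gauge \<gamma> \<and> (\<forall>\<D>. \<D> tagged_division_of {a..b} \<and> \<gamma> fine \<D> \<longrightarrow>
        norm ((\<Sum>(t,K)\<in>\<D>. measure lborel K *\<^sub>R F' t) - (x b - x a)) < e)"
      by (intro exI[of _ g]) simp
  qed
  then show ?thesis
    by (rule has_integral_spike[OF \<open>negligible N\<close>, rotated]) (auto simp: F'_def)
qed

lemma lipschitz_imp_abs_continuous_on:
  fixes x :: "real \<Rightarrow> 'a::real_normed_vector"
  assumes lip: "\<And>s t. s \<in> {a..b} \<Longrightarrow> t \<in> {a..b} \<Longrightarrow> norm (x t - x s) \<le> M * \<bar>t - s\<bar>"
  shows "abs_continuous_on a b x"
  unfolding abs_continuous_on_def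
proof (intro allI impI)
  fix \<epsilon> :: real assume "\<epsilon> > 0"
  \<comment> \<open>\<open>M\<close> may be zero or negative, and the witness divides by
    \<open>M'\<close>.\<close>
  define M' where "M' = max M 1"
  have "M' > 0" "M \<le> M'" by (auto simp: M'_def)
  show "\<exists>\<delta>>0. \<forall>(n::nat) u v. (\<forall>i<n. u i \<le> v i \<and> {u i..v i} \<subseteq> {a..b}) \<longrightarrow>
        (\<forall>i<n. \<forall>j<n. i \<noteq> j \<longrightarrow> {u i<..<v i} \<inter> {u j<..<v j} = {}) \<longrightarrow>
        (\<Sum>i<n. v i - u i) < \<delta> \<longrightarrow> (\<Sum>i<n. norm (x (v i) - x (u i))) < \<epsilon>"
  proof (intro exI[of _ "\<epsilon> / M'"] conjI allI impI)
    show "\<epsilon> / M' > 0" using \<open>\<epsilon> > 0\<close> \<open>M' > 0\<close> by simp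
    fix n :: nat and u v
    assume uv: "\<forall>i<n. u i \<le> v i \<and> {u i..v i} \<subseteq> {a..b}" "(\<Sum>i<n. v i - u i) < \<epsilon> / M'"
    have "(\<Sum>i<n. norm (x (v i) - x (u i))) \<le> (\<Sum>i<n. M' * (v i - u i))"
    proof (rule sum_mono)
      fix i assume "i \<in> {..<n}"
      then have i: "u i \<le> v i" "u i \<in> {a..b}" "v i \<in> {a..b}" using uv(1) by auto
      then have "norm (x (v i) - x (u i)) \<le> M * \<bar>v i - u i\<bar>" by (intro lip)
      also have "\<dots> \<le> M' * (v i - u i)" using i \<open>M \<le> M'\<close> by (auto intro: mult_right_mono)
      finally show "norm (x (v i) - x (u i)) \<le> M' * (v i - u i)" .
    qed
    also have "\<dots> = M' * (\<Sum>i<n. v i - u i)" by (simp add: sum_distrib_left)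
    also have "\<dots> < \<epsilon>" using uv(2) \<open>M' > 0\<close> by (simp add: field_simps)
    finally show "(\<Sum>i<n. norm (x (v i) - x (u i))) < \<epsilon>" .
  qed
qed

section \<open>Switching signals\<close>

text \<open>A jump at \<open>s\<close> is allowed: right-continuity carries the constant value just
  after \<open>s\<close> back to \<open>s\<close> itself.\<close>

lemma switching_signal_constant:
  assumes \<sigma>: "switching_signal \<Gamma> \<sigma>" and "s \<le> t" and no: "{s<..t} \<inter> jumps \<sigma> = {}"
  shows "\<sigma> s = \<sigma> t"
proof (cases "s = t")
  case False
  with \<open>s \<le> t\<close> have "s < t" by simp
  have "\<sigma> u = \<sigma> t" if "s < u" "u < t" for u
  proof -
    have "{u..t} \<subseteq> {s<..t}" using that by auto
    then have "{u..t} \<inter> jumps \<sigma> = {}" using no by blast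
    then show ?thesis using \<sigma> that unfolding switching_signal_def by auto
  qed
  then have "\<forall>\<^sub>F u in at_right s. \<sigma> u = \<sigma> t"
    using \<open>s < t\<close> unfolding eventually_at_right_field by blast
  then have "(\<sigma> \<longlongrightarrow> \<sigma> t) (at_right s)" by (rule tendsto_eventually)
  moreover have "(\<sigma> \<longlongrightarrow> \<sigma> s) (at_right s)"
    using \<sigma> by (simp add: switching_signal_def continuous_within)
  ultimately show ?thesis
    by (intro tendsto_unique[OF trivial_limit_at_right_real])
qed simp

text \<open>Since \<open>\<delta> < \<tau>\<close>, at most one jump lies between \<open>a\<close>,
  excluded, and \<open>a + \<delta>\<close>, included; \<open>p\<close> is this jump. A jump at
  \<open>a\<close> does not count, because \<open>\<sigma> a\<close> is already the value after
  it.\<close>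

lemma signals_with_dwell_bin:
  assumes \<sigma>: "\<sigma> \<in> signals_with_dwell \<Gamma> \<tau>" and "0 < \<delta>" "\<delta> < \<tau>"
  obtains p where "a < p" "p \<le> a + \<delta>" "\<And>s. a \<le> s \<Longrightarrow> s < p \<Longrightarrow> \<sigma> s = \<sigma> a"
    "\<And>s. p \<le> s \<Longrightarrow> s \<le> a + \<delta> \<Longrightarrow> \<sigma> s = \<sigma> (a + \<delta>)"
    "\<sigma> a \<noteq> \<sigma> (a + \<delta>) \<Longrightarrow> p \<in> jumps \<sigma>"
proof -
  have sw: "switching_signal \<Gamma> \<sigma>"
    and dw: "\<And>t t'. \<lbrakk>t \<in> jumps \<sigma>; t' \<in> jumps \<sigma>; t \<noteq> t'\<rbrakk> \<Longrightarrow> \<bar>t - t'\<bar> \<ge> \<tau>"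
    using \<sigma> by (auto simp: signals_with_dwell_def)
  show ?thesis
  proof (cases "{a<..a+\<delta>} \<inter> jumps \<sigma> = {}")
    case True
    have "\<sigma> a = \<sigma> s" if s: "a \<le> s" "s \<le> a + \<delta>" for s
    proof (rule switching_signal_constant[OF sw s(1)])
      have "{a<..s} \<subseteq> {a<..a+\<delta>}" using s by auto
      then show "{a<..s} \<inter> jumps \<sigma> = {}" using True by blast
    qed
    \<comment> \<open>Without a jump the right end is a harmless default for
      \<open>p\<close>.\<close>
    from this this[of "a + \<delta>"] \<open>0 < \<delta>\<close> show ?thesis
      by (intro that[of "a + \<delta>"]) auto
  next
    case False
    then obtain p where p: "a < p" "p \<le> a + \<delta>" "p \<in> jumps \<sigma>" by auto
    have uniq: "t = p" if "a < t" "t \<le> a + \<delta>" "t \<in> jumps \<sigma>" for t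
      using dw[of t p] p that \<open>\<delta> < \<tau>\<close> by (cases "t = p") auto
    show ?thesis
    proof (rule that[of p])
      fix s assume s: "a \<le> s" "s < p"
      have "t \<notin> jumps \<sigma>" if "t \<in> {a<..s}" for t using uniq[of t] that s p by auto
      then have "{a<..s} \<inter> jumps \<sigma> = {}" by blast
      then show "\<sigma> s = \<sigma> a" using switching_signal_constant[OF sw s(1)] by simp
    next
      fix s assume s: "p \<le> s" "s \<le> a + \<delta>"
      have "t \<notin> jumps \<sigma>" if "t \<in> {s<..a+\<delta>}" for t using uniq[of t] that s p by auto
      then have "{s<..a+\<delta>} \<inter> jumps \<sigma> = {}" by blast
      then show "\<sigma> s = \<sigma> (a + \<delta>)" using switching_signal_constant[OF sw s(2)] by simp
    qed (use p in auto)
  qed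
qed

lemma Lim_at_left_eq:
  fixes \<sigma> :: "real \<Rightarrow> 'g::t2_space"
  assumes "a < p" "\<And>s. a \<le> s \<Longrightarrow> s < p \<Longrightarrow> \<sigma> s = \<gamma>"
  shows "Lim (at_left p) \<sigma> = \<gamma>"
proof (rule tendsto_Lim[OF trivial_limit_at_left_real])
  have "\<forall>\<^sub>F s in at_left p. \<sigma> s = \<gamma>"
    unfolding eventually_at_left_field by (rule exI[of _ a]) (use assms in auto)
  then show "(\<sigma> \<longlongrightarrow> \<gamma>) (at_left p)" by (rule tendsto_eventually)
qed

section \<open>Subsequences\<close>

text \<open>For each \<open>i\<close>, a tail of the diagonal sequence is a subsequence of one that
  was chosen to satisfy \<open>Q i\<close>. This is why \<open>Q i\<close> must be inherited by
  subsequences and must not depend on finitely many initial terms.\<close>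

lemma diagonal_subsequence:
  fixes Q :: "'i::countable \<Rightarrow> (nat \<Rightarrow> nat) \<Rightarrow> bool"
  assumes ex: "\<And>i s. strict_mono (s :: nat \<Rightarrow> nat) \<Longrightarrow> \<exists>r :: nat \<Rightarrow> nat. strict_mono r \<and> Q i (s \<circ> r)"
    and sub: "\<And>i s r. strict_mono (r :: nat \<Rightarrow> nat) \<Longrightarrow> Q i s \<Longrightarrow> Q i (s \<circ> r)"
    and tail: "\<And>i s n. Q i (\<lambda>k. s (k + n)) \<Longrightarrow> Q i s"
  shows "\<exists>r. strict_mono r \<and> (\<forall>i. Q i r)"
proof -
  interpret subseqs "\<lambda>n. Q (from_nat n)"
    by unfold_locales (rule ex)
  have "Q i diagseq" for i
  proof -
    have "Q (from_nat (to_nat i)) (diagseq \<circ> (+) (Suc (to_nat i)))"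
      by (rule diagseq_holds) (rule sub)
    then have "Q i (\<lambda>k. diagseq (k + Suc (to_nat i)))"
      by (simp add: comp_def add.commute)
    then show ?thesis by (rule tail)
  qed
  then show ?thesis using subseq_diagseq by blast
qed

lemma finite_range_subsequence:
  fixes G :: "nat \<Rightarrow> 'g"
  assumes "finite \<Gamma>" "\<And>k. G k \<in> \<Gamma>"
  shows "\<exists>r \<gamma>. strict_mono (r :: nat \<Rightarrow> nat) \<and> (\<forall>k. G (r k) = \<gamma>)"
proof -
  have "\<exists>k0. infinite {k \<in> UNIV. G k = G k0}"
    using pigeonhole_infinite[of "UNIV :: nat set" G] assms finite_subset[of "range G" \<Gamma>] by auto
  then obtain k0 where "infinite {k. G k = G k0}" by auto
  then show ?thesis
    using infinite_enumerate[of "{k. G k = G k0}"] by auto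
qed

text \<open>The states of a translate at a given time are known to lie in the compact set only for
  large \<open>k\<close>, hence the form of the hypothesis.\<close>

lemma compact_eventually_subsequence:
  fixes X :: "nat \<Rightarrow> 'a::metric_space"
  assumes "compact B" "\<forall>\<^sub>F k in sequentially. X k \<in> B"
  shows "\<exists>r y. strict_mono (r :: nat \<Rightarrow> nat) \<and> (\<lambda>k. X (r k)) \<longlonglongrightarrow> y"
proof -
  obtain N where N: "\<And>k. k \<ge> N \<Longrightarrow> X k \<in> B"
    using assms(2) by (auto simp: eventually_sequentially)
  have "\<forall>k. X (k + N) \<in> B" using N by simp
  then have "\<exists>y\<in>B. \<exists>r. strict_mono (r :: nat \<Rightarrow> nat) \<and> ((\<lambda>k. X (k + N)) \<circ> r) \<longlonglongrightarrow> y"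
    using compact_imp_seq_compact[OF assms(1)] by (simp add: seq_compact_def)
  then obtain y and r :: "nat \<Rightarrow> nat" where r: "strict_mono r" "((\<lambda>k. X (k + N)) \<circ> r) \<longlonglongrightarrow> y"
    by blast
  show ?thesis
    by (rule exI[of _ "\<lambda>k. r k + N"], rule exI[of _ y]) (use r in \<open>auto simp: strict_mono_def comp_def\<close>)
qed

text \<open>Working with pairs of indices lets a single diagonal argument serve modes, switching
  times and states. The modes are asked to be eventually constant, not constant, because the
  property must survive a change of finitely many terms.\<close>

lemma common_convergent_subsequence:
  fixes G :: "nat \<Rightarrow> 'i::countable \<Rightarrow> 'g" and P :: "nat \<Rightarrow> 'i \<Rightarrow> real"
    and X :: "nat \<Rightarrow> 'j::countable \<Rightarrow> 'a::metric_space"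
  assumes fin: "finite \<Gamma>" and G: "\<And>k i. G k i \<in> \<Gamma>"
    and P: "\<And>k i. P k i \<in> {l i..u i}"
    and B: "compact B" and X: "\<And>j. \<forall>\<^sub>F k in sequentially. X k j \<in> B"
  obtains r g p y where "strict_mono r" "\<And>i. \<forall>\<^sub>F k in sequentially. G (r k) i = g i"
    "\<And>i. (\<lambda>k. P (r k) i) \<longlonglongrightarrow> p i" "\<And>j. (\<lambda>k. X (r k) j) \<longlonglongrightarrow> y j"
proof -
  define Q where "Q ij s \<longleftrightarrow> (\<exists>\<gamma>. \<forall>\<^sub>F k in sequentially. G (s k) (fst ij) = \<gamma>) \<and>
    (\<exists>p. (\<lambda>k. P (s k) (fst ij)) \<longlonglongrightarrow> p) \<and> (\<exists>y. (\<lambda>k. X (s k) (snd ij)) \<longlonglongrightarrow> y)"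
    for ij :: "'i \<times> 'j" and s
  have "\<exists>r. strict_mono r \<and> (\<forall>ij. Q ij r)"
  proof (rule diagonal_subsequence[of Q])
    fix ij :: "'i \<times> 'j" and s :: "nat \<Rightarrow> nat" assume s: "strict_mono s"
    have "\<exists>r1 \<gamma>. strict_mono (r1 :: nat \<Rightarrow> nat) \<and> (\<forall>k. G (s (r1 k)) (fst ij) = \<gamma>)"
      using G by (intro finite_range_subsequence[OF fin])
    then obtain r1 :: "nat \<Rightarrow> nat" and \<gamma> where r1: "strict_mono r1" "\<forall>k. G (s (r1 k)) (fst ij) = \<gamma>"
      by blast
    have "\<exists>r2 p. strict_mono (r2 :: nat \<Rightarrow> nat) \<and> (\<lambda>k. P (s (r1 (r2 k))) (fst ij)) \<longlonglongrightarrow> p"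
      using P by (intro compact_eventually_subsequence[OF compact_Icc[of "l (fst ij)" "u (fst ij)"]]
          always_eventually) simp
    then obtain r2 :: "nat \<Rightarrow> nat" and p where r2: "strict_mono r2" "(\<lambda>k. P (s (r1 (r2 k))) (fst ij)) \<longlonglongrightarrow> p"
      by blast
    have s12: "strict_mono (\<lambda>k. s (r1 (r2 k)))"
      using s r1 r2 by (simp add: strict_mono_def)
    have "\<exists>r3 y. strict_mono (r3 :: nat \<Rightarrow> nat) \<and> (\<lambda>k. X (s (r1 (r2 (r3 k)))) (snd ij)) \<longlonglongrightarrow> y"
      by (rule compact_eventually_subsequence[OF B eventually_subseq[OF s12 X[of "snd ij"]]])
    then obtain r3 :: "nat \<Rightarrow> nat" and y where r3: "strict_mono r3" "(\<lambda>k. X (s (r1 (r2 (r3 k)))) (snd ij)) \<longlonglongrightarrow> y"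
      by blast
    show "\<exists>r. strict_mono r \<and> Q ij (s \<circ> r)"
    proof (intro exI conjI)
      show "strict_mono (\<lambda>k. r1 (r2 (r3 k)))"
        using r1 r2 r3 by (simp add: strict_mono_def)
      show "Q ij (s \<circ> (\<lambda>k. r1 (r2 (r3 k))))"
        using r1(2) LIMSEQ_subseq_LIMSEQ[OF r2(2) r3(1)] r3(2)
        unfolding Q_def by (auto simp: comp_def)
    qed
  next
    fix ij :: "'i \<times> 'j" and s r :: "nat \<Rightarrow> nat"
    assume r: "strict_mono r" and "Q ij s"
    then obtain \<gamma> p y where "\<forall>\<^sub>F k in sequentially. G (s k) (fst ij) = \<gamma>"
      "(\<lambda>k. P (s k) (fst ij)) \<longlonglongrightarrow> p" "(\<lambda>k. X (s k) (snd ij)) \<longlonglongrightarrow> y"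
      unfolding Q_def by (elim exE conjE, intro that)
    then have "\<forall>\<^sub>F k in sequentially. G (s (r k)) (fst ij) = \<gamma>"
      "(\<lambda>k. P (s (r k)) (fst ij)) \<longlonglongrightarrow> p" "(\<lambda>k. X (s (r k)) (snd ij)) \<longlonglongrightarrow> y"
      using eventually_subseq[OF r, of "\<lambda>k. G (s k) (fst ij) = \<gamma>"]
        LIMSEQ_subseq_LIMSEQ[OF _ r, of "\<lambda>k. P (s k) (fst ij)"]
        LIMSEQ_subseq_LIMSEQ[OF _ r, of "\<lambda>k. X (s k) (snd ij)"]
      by (simp_all add: comp_def)
    then show "Q ij (s \<circ> r)"
      unfolding Q_def comp_def by (intro conjI exI)
  next
    fix ij :: "'i \<times> 'j" and s :: "nat \<Rightarrow> nat" and n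
    assume "Q ij (\<lambda>k. s (k + n))"
    then obtain \<gamma> p y where "\<forall>\<^sub>F k in sequentially. G (s (k + n)) (fst ij) = \<gamma>"
      "(\<lambda>k. P (s (k + n)) (fst ij)) \<longlonglongrightarrow> p" "(\<lambda>k. X (s (k + n)) (snd ij)) \<longlonglongrightarrow> y"
      unfolding Q_def by (elim exE conjE, intro that)
    then have "\<forall>\<^sub>F k in sequentially. G (s k) (fst ij) = \<gamma>"
      "(\<lambda>k. P (s k) (fst ij)) \<longlonglongrightarrow> p" "(\<lambda>k. X (s k) (snd ij)) \<longlonglongrightarrow> y"
      using eventually_sequentially_seg[of "\<lambda>k. G (s k) (fst ij) = \<gamma>" n]
        LIMSEQ_offset[of "\<lambda>k. P (s k) (fst ij)" n] LIMSEQ_offset[of "\<lambda>k. X (s k) (snd ij)" n]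
      by simp_all
    then show "Q ij s"
      unfolding Q_def by (intro conjI exI)
  qed
  then obtain r :: "nat \<Rightarrow> nat" where r: "strict_mono r" "\<And>ij. Q ij r" by blast
  define g where "g i = (SOME \<gamma>. \<forall>\<^sub>F k in sequentially. G (r k) i = \<gamma>)" for i
  define p where "p i = lim (\<lambda>k. P (r k) i)" for i
  define y where "y j = lim (\<lambda>k. X (r k) j)" for j
  show ?thesis
  proof (rule that[OF r(1), of g p y])
    show "\<forall>\<^sub>F k in sequentially. G (r k) i = g i" for i
      unfolding g_def by (rule someI_ex) (use r(2)[of "(i, undefined)"] in \<open>simp add: Q_def\<close>)
    show "(\<lambda>k. P (r k) i) \<longlonglongrightarrow> p i" for i
      unfolding p_def convergent_LIMSEQ_iff[symmetric] convergent_def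
      using r(2)[of "(i, undefined)"] by (simp add: Q_def)
    show "(\<lambda>k. X (r k) j) \<longlonglongrightarrow> y j" for j
      unfolding y_def convergent_LIMSEQ_iff[symmetric] convergent_def
      using r(2)[of "(undefined, j)"] by (simp add: Q_def)
  qed
qed

text \<open>This is the density step of the Arzela-Ascoli theorem: a rational time near
  \<open>t\<close> transfers its Cauchy property to \<open>t\<close> through the common Lipschitz
  constant. The threshold in \<open>lip\<close> may depend on both times, since a translate is
  controlled only once its time is nonnegative.\<close>

lemma tendsto_of_rat_imp_tendsto:
  fixes X :: "nat \<Rightarrow> real \<Rightarrow> 'a::banach"
  assumes rat: "\<And>q. convergent (\<lambda>k. X k (of_rat q))" and "M \<ge> 0"
    and lip: "\<And>t u. \<forall>\<^sub>F k in sequentially. norm (X k t - X k u) \<le> M * \<bar>t - u\<bar>"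
  shows "(\<lambda>k. X k t) \<longlonglongrightarrow> lim (\<lambda>k. X k t)"
proof -
  have "Cauchy (\<lambda>k. X k t)"
    unfolding Cauchy_iff
  proof (intro allI impI)
    fix e :: real assume "e > 0"
    \<comment> \<open>Each of the two moves to the rational time may cost \<open>e / 3\<close>;
      \<open>M + 1\<close> avoids a division by zero.\<close>
    define d where "d = e / (3 * (M + 1))"
    have "d > 0" using \<open>e > 0\<close> \<open>M \<ge> 0\<close> by (simp add: d_def)
    then obtain q where q: "t < real_of_rat q" "real_of_rat q < t + d"
      using of_rat_dense[of t "t + d"] by auto
    have "M * \<bar>t - real_of_rat q\<bar> \<le> (M + 1) * d"
      using q \<open>M \<ge> 0\<close> \<open>d > 0\<close> by (intro mult_mono) auto
    also have "\<dots> = e / 3" using \<open>M \<ge> 0\<close> by (simp add: d_def field_simps)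
    finally have small: "M * \<bar>t - real_of_rat q\<bar> \<le> e / 3" .
    obtain N1 where N1: "\<And>k. k \<ge> N1 \<Longrightarrow> norm (X k t - X k (of_rat q)) \<le> M * \<bar>t - of_rat q\<bar>"
      using lip[of t "of_rat q"] by (auto simp: eventually_sequentially)
    have "Cauchy (\<lambda>k. X k (of_rat q))"
      using rat[of q] by (rule convergent_Cauchy)
    then obtain N2 where N2: "\<And>k l. k \<ge> N2 \<Longrightarrow> l \<ge> N2 \<Longrightarrow> norm (X k (of_rat q) - X l (of_rat q)) < e / 3"
      using \<open>e > 0\<close> unfolding Cauchy_iff by (metis divide_pos_pos zero_less_numeral)
    show "\<exists>N. \<forall>k\<ge>N. \<forall>l\<ge>N. norm (X k t - X l t) < e"
    proof (intro exI[of _ "max N1 N2"] allI impI)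
      fix k l assume kl: "k \<ge> max N1 N2" "l \<ge> max N1 N2"
      have "X k t - X l t = (X k t - X k (of_rat q)) + (X k (of_rat q) - X l (of_rat q)) - (X l t - X l (of_rat q))"
        by simp
      also have "norm \<dots> \<le> norm (X k t - X k (of_rat q)) + norm (X k (of_rat q) - X l (of_rat q))
          + norm (X l t - X l (of_rat q))"
        using norm_triangle_ineq4 norm_triangle_ineq by (meson add_right_mono order_trans)
      also have "\<dots> < e"
        using N1[of k] N1[of l] N2[of k l] small kl by simp
      finally show "norm (X k t - X l t) < e" .
    qed
  qed
  then show ?thesis
    by (simp add: Cauchy_convergent_iff convergent_LIMSEQ_iff)
qed

section \<open>Cycles\<close>

text \<open>A closed walk of minimal length is a simple cycle.\<close>

lemma simple_cycle_of_cyclic: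
  fixes E :: "('g \<times> 'g) set"
  assumes "\<not> acyclic E" and "irrefl E" and E: "\<And>\<gamma> \<gamma>'. (\<gamma>, \<gamma>') \<in> E \<Longrightarrow> \<gamma> \<in> \<Gamma> \<and> \<gamma>' \<in> H \<gamma>"
  shows "\<exists>m c. simple_cycle \<Gamma> H m c \<and> (\<forall>j\<in>{1..m-1}. (c j, c (j + 1)) \<in> E)"
proof -
  define closed_walk where "closed_walk n \<longleftrightarrow> n > 0 \<and> (\<exists>\<gamma>. (\<gamma>, \<gamma>) \<in> E ^^ n)" for n
  have "\<exists>n. closed_walk n"
    using assms(1) unfolding acyclic_def closed_walk_def by (auto simp: trancl_power)
  define n where "n = (LEAST n. closed_walk n)"
  have "closed_walk n" unfolding n_def using \<open>\<exists>n. closed_walk n\<close> by (rule LeastI_ex)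
  have min: "n \<le> k" if "closed_walk k" for k
    unfolding n_def using that by (rule Least_le)
  obtain \<gamma> where "(\<gamma>, \<gamma>) \<in> E ^^ n" and "n > 0"
    using \<open>closed_walk n\<close> unfolding closed_walk_def by blast
  then have "\<exists>w. w 0 = \<gamma> \<and> w n = \<gamma> \<and> (\<forall>i<n. (w i, w (Suc i)) \<in> E)"
    by (simp only: relpow_fun_conv)
  then obtain w :: "nat \<Rightarrow> 'g" where w': "w 0 = \<gamma>" "w n = \<gamma>" "\<forall>i<n. (w i, w (Suc i)) \<in> E"
    by blast
  then have w: "w 0 = w n" "\<And>i. i < n \<Longrightarrow> (w i, w (Suc i)) \<in> E"
    by simp_all
  \<comment> \<open>Without loops the walk has at least two edges, hence at least three entries, as
    \<open>simple_cycle\<close> demands.\<close>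
  have "n \<noteq> 1"
    using w(1) w(2)[of 0] \<open>irrefl E\<close> by (auto simp: irrefl_def)
  with \<open>n > 0\<close> have "n \<ge> 2" by simp
  \<comment> \<open>Equal vertices at \<open>i\<close> and \<open>j\<close> cut out a closed walk of
    length \<open>j - i\<close>, which minimality forces to be the whole walk.\<close>
  have simple: "i = 0 \<and> j = n" if "i < j" "j \<le> n" "w i = w j" for i j
  proof -
    have "(w i, w i) \<in> E ^^ (j - i)"
      unfolding relpow_fun_conv
      by (rule exI[of _ "\<lambda>k. w (i + k)"]) (use that w(2) in auto)
    then have "closed_walk (j - i)" using that unfolding closed_walk_def by auto
    then show ?thesis using min[of "j - i"] that by auto
  qed
  \<comment> \<open>Cycles are numbered from 1, walks from 0.\<close>
  define c where "c i = w (i - 1)" for i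
  have edge: "(c j, c (j + 1)) \<in> E" if "j \<in> {1..n}" for j
    using w(2)[of "j - 1"] that by (auto simp: c_def)
  have "c 1 = c (n + 1)" using w(1) by (simp add: c_def)
  moreover have "c i \<in> \<Gamma>" if "i \<in> {1..n + 1}" for i
  proof (cases "i = n + 1")
    case True
    then show ?thesis using calculation edge[of 1] \<open>n > 0\<close> E by auto
  next
    case False
    then show ?thesis using edge[of i] that E by auto
  qed
  moreover have "i = 1 \<and> j = n + 1"
    if "i \<in> {1..n+1}" "j \<in> {1..n+1}" "c i = c j" "i < j" for i j
    using simple[of "i - 1" "j - 1"] that by (simp add: c_def) linarith
  ultimately have "simple_cycle \<Gamma> H (n + 1) c"
    using \<open>n \<ge> 2\<close> edge E unfolding simple_cycle_def by auto
  moreover have "\<forall>j\<in>{1..n + 1 - 1}. (c j, c (j + 1)) \<in> E" using edge by simp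
  ultimately show ?thesis by blast
qed

text \<open>Every change of value is a step down in the well-founded converse of \<open>R\<close>,
  so only finitely many changes can occur. The induction runs over the current value, not over the
  index.\<close>

lemma wf_converse_eventually_constant:
  fixes h :: "nat \<Rightarrow> 'g"
  assumes wf: "wf (R\<inverse>)" and step: "\<And>n. h n \<noteq> h (Suc n) \<Longrightarrow> (h n, h (Suc n)) \<in> R"
  shows "\<exists>N. \<forall>n\<ge>N. h n = h N"
proof -
  have *: "\<forall>N. h N = \<gamma> \<longrightarrow> (\<exists>N. \<forall>n\<ge>N. h n = h N)" for \<gamma>
    using wf
  proof (induction \<gamma>)
    case (less \<gamma>)
    show ?case
    proof (intro allI impI)
      fix N assume N: "h N = \<gamma>"
      show "\<exists>N. \<forall>n\<ge>N. h n = h N"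
      proof (cases "\<forall>n\<ge>N. h n = \<gamma>")
        case True
        then show ?thesis using N by blast
      next
        case False
        then have ex: "\<exists>d. h (N + d) \<noteq> \<gamma>" by (metis le_iff_add)
        \<comment> \<open>The first departure from \<open>\<gamma>\<close>: the preceding term still
          equals \<open>\<gamma>\<close>, so the induction hypothesis applies to the new
          value.\<close>
        define d where "d = (LEAST d. h (N + d) \<noteq> \<gamma>)"
        have d: "h (N + d) \<noteq> \<gamma>" unfolding d_def using ex by (rule LeastI_ex)
        then have "d \<noteq> 0" using N by (metis add.right_neutral)
        then obtain e where e: "d = Suc e" using not0_implies_Suc by blast
        have "h (N + e) = \<gamma>" using not_less_Least[of e "\<lambda>d. h (N + d) \<noteq> \<gamma>"] e d_def by auto
        then have "(\<gamma>, h (N + d)) \<in> R" using step[of "N + e"] d e by auto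
        then show ?thesis using less[of "h (N + d)"] by auto
      qed
    qed
  qed
  show ?thesis using *[of "h 0"] by blast
qed

section \<open>Limits of translated trajectories\<close>

text \<open>Unlike \<open>is_solution\<close>, this asks for a derivative at every time, one-sided
  at the ends; the chain rule for \<open>V\<close> will be used at the ends too.\<close>

definition autonomous_arc :: "'a::real_normed_vector set \<Rightarrow> ('a \<Rightarrow> 'a) \<Rightarrow> real \<Rightarrow> real \<Rightarrow> (real \<Rightarrow> 'a) \<Rightarrow> bool" where
  "autonomous_arc X F a b y \<longleftrightarrow>
     (\<forall>t\<in>{a..b}. y t \<in> X \<and> (y has_vector_derivative F (y t)) (at t within {a..b}))"

locale bounded_trajectory =
  fixes \<Gamma> :: "'g::metric_space set" and domf :: "('a::euclidean_space \<times> 'g) set"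
    and f :: "'a \<times> 'g \<Rightarrow> 'a" and I :: "real set" and x :: "real \<Rightarrow> 'a" and \<sigma> :: "real \<Rightarrow> 'g"
    and B :: "'a set"
  assumes finite_modes: "finite \<Gamma>" and closed_domf: "closed domf" and cont_f: "continuous_on domf f"
    and traj: "trajectory \<Gamma> domf f I x \<sigma>" and complete: "{0..} \<subseteq> I"
    and compact_B: "compact B" and x_in_B: "\<And>t. t \<in> I \<Longrightarrow> x t \<in> B"
begin

lemma mode_in: "\<sigma> t \<in> \<Gamma>"
  using traj by (auto simp: trajectory_def switching_signal_def)

lemma state_in: "t \<ge> 0 \<Longrightarrow> (x t, \<sigma> t) \<in> domf" and state_in_B: "t \<ge> 0 \<Longrightarrow> x t \<in> B"
  using traj complete x_in_B by (auto simp: trajectory_def is_solution_def slice_def)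

lemma closed_slice: "closed (slice domf \<gamma>)"
proof -
  have "slice domf \<gamma> = (\<lambda>\<xi>. (\<xi>, \<gamma>)) -` domf" by (auto simp: slice_def)
  moreover have "continuous_on UNIV (\<lambda>\<xi>::'a. (\<xi>, \<gamma>))" by (intro continuous_intros)
  ultimately show ?thesis using closed_domf by (simp add: closed_vimage)
qed

lemma cont_slice: "continuous_on (slice domf \<gamma>) (\<lambda>\<xi>. f (\<xi>, \<gamma>))"
  by (rule continuous_on_compose2[OF cont_f]) (auto simp: slice_def intro!: continuous_intros)

text \<open>Fixed once for the locale, as all translates of \<open>x\<close> must share one
  Lipschitz constant. Such an \<open>M\<close> exists because finiteness of \<open>\<Gamma>\<close>
  makes the set compact.\<close>

definition speed :: real where
  "speed = (SOME M. M \<ge> 0 \<and> (\<forall>z \<in> domf \<inter> (B \<times> \<Gamma>). norm (f z) \<le> M))"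

lemma speed: "speed \<ge> 0" "t \<ge> 0 \<Longrightarrow> norm (f (x t, \<sigma> t)) \<le> speed"
proof -
  have "compact (domf \<inter> (B \<times> \<Gamma>))"
    by (intro closed_Int_compact closed_domf compact_Times compact_B finite_imp_compact[OF finite_modes])
  then have "bounded (f ` (domf \<inter> (B \<times> \<Gamma>)))"
    by (intro compact_imp_bounded compact_continuous_image continuous_on_subset[OF cont_f]) auto
  then obtain M where "\<forall>z \<in> domf \<inter> (B \<times> \<Gamma>). norm (f z) \<le> M"
    by (auto simp: bounded_iff)
  then have "\<exists>M. M \<ge> 0 \<and> (\<forall>z \<in> domf \<inter> (B \<times> \<Gamma>). norm (f z) \<le> M)"
    by (intro exI[of _ "max M 0"]) force
  then have *: "speed \<ge> 0 \<and> (\<forall>z \<in> domf \<inter> (B \<times> \<Gamma>). norm (f z) \<le> speed)"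
    unfolding speed_def by (rule someI_ex)
  then show "speed \<ge> 0" by simp
  show "norm (f (x t, \<sigma> t)) \<le> speed" if "t \<ge> 0"
    using * state_in[OF that] state_in_B[OF that] mode_in by blast
qed

text \<open>Pointwise convergence of the translates says nothing about their derivatives, but it
  respects integrals of bounded integrands; this form of the equation is the one that passes to the
  limit.\<close>

lemma velocity_has_integral:
  assumes "0 \<le> a" "a \<le> b"
  shows "((\<lambda>t. f (x t, \<sigma> t)) has_integral (x b - x a)) {a..b}"
proof (rule abs_continuous_on_has_integral[OF _ assms(2)])
  have sub: "{a..b} \<subseteq> I" using complete assms by auto
  show "abs_continuous_on a b x"
    using traj sub assms by (auto simp: trajectory_def is_solution_def locally_abs_continuous_on_def)
  have "AE t in lebesgue. t \<in> I \<longrightarrow> (x has_vector_derivative f (x t, \<sigma> t)) (at t within I)"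
    using traj by (simp add: trajectory_def is_solution_def)
  then show "AE t in lebesgue. t \<in> {a..b} \<longrightarrow> (x has_vector_derivative f (x t, \<sigma> t)) (at t within {a..b})"
    by eventually_elim (use sub in \<open>auto intro: has_vector_derivative_within_subset\<close>)
qed

lemma x_lipschitz:
  assumes "0 \<le> s" "0 \<le> t"
  shows "norm (x t - x s) \<le> speed * \<bar>t - s\<bar>"
proof -
  have "norm (x b - x a) \<le> speed * (b - a)" if "0 \<le> a" "a \<le> b" for a b
    using has_integral_bound_real[OF speed(1) finite.emptyI velocity_has_integral[OF that]] that speed(2) by auto
  from this[of s t] this[of t s] assms show ?thesis
    by (cases "s \<le> t") (auto simp: norm_minus_commute)
qed

end

text \<open>Only the states are assumed to converge here. What is known of the limiting mode enters
  through the hypotheses \<open>mode\<close>, with a threshold for \<open>k\<close> that may depend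
  on the time \<open>t\<close>.\<close>

locale trajectory_limit = bounded_trajectory \<Gamma> domf f I x \<sigma> B
  for \<Gamma> :: "'g::metric_space set" and domf :: "('a::euclidean_space \<times> 'g) set"
    and f :: "'a \<times> 'g \<Rightarrow> 'a" and I :: "real set" and x :: "real \<Rightarrow> 'a" and \<sigma> :: "real \<Rightarrow> 'g"
    and B :: "'a set" +
  fixes s :: "nat \<Rightarrow> real" and y :: "real \<Rightarrow> 'a"
  assumes s_at_top: "filterlim s at_top sequentially"
    and x_tendsto: "\<And>t. (\<lambda>k. x (t + s k)) \<longlonglongrightarrow> y t"
begin

lemma shift_nonneg: "\<forall>\<^sub>F k in sequentially. 0 \<le> t + s k"
proof -
  have "\<forall>\<^sub>F k in sequentially. - t \<le> s k"
    using s_at_top by (simp add: filterlim_at_top)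
  then show ?thesis by eventually_elim simp
qed

lemma limit_in_B: "y t \<in> B"
proof (rule Lim_in_closed_set[OF compact_imp_closed[OF compact_B] _ sequentially_bot x_tendsto])
  show "\<forall>\<^sub>F k in sequentially. x (t + s k) \<in> B"
    using shift_nonneg[of t] by eventually_elim (rule state_in_B)
qed

lemma limit_lipschitz: "norm (y t - y u) \<le> speed * \<bar>t - u\<bar>"
proof (rule Lim_norm_ubound[OF sequentially_bot])
  show "(\<lambda>k. x (t + s k) - x (u + s k)) \<longlonglongrightarrow> y t - y u"
    by (intro tendsto_diff x_tendsto)
  show "\<forall>\<^sub>F k in sequentially. norm (x (t + s k) - x (u + s k)) \<le> speed * \<bar>t - u\<bar>"
    using shift_nonneg[of t] shift_nonneg[of u]
    by eventually_elim (use x_lipschitz in fastforce)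
qed

lemma limit_continuous: "continuous_on S y"
proof -
  have "speed-lipschitz_on S y"
    using limit_lipschitz speed(1) by (auto simp: lipschitz_on_def dist_norm)
  then show ?thesis by (rule lipschitz_on_continuous_on)
qed

lemma limit_in_slice_open:
  assumes "\<forall>\<^sub>F k in sequentially. \<sigma> (t + s k) = \<gamma>"
  shows "y t \<in> slice domf \<gamma>"
proof (rule Lim_in_closed_set[OF closed_slice _ sequentially_bot x_tendsto])
  show "\<forall>\<^sub>F k in sequentially. x (t + s k) \<in> slice domf \<gamma>"
    using assms shift_nonneg[of t]
    by eventually_elim (use state_in in \<open>auto simp: slice_def\<close>)
qed

text \<open>The mode is prescribed only inside the interval, because the switching times of the
  translates merely converge to its ends. Continuity of \<open>y\<close> and closedness of the slice
  reach the ends.\<close>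

lemma limit_in_slice:
  assumes "a < b" and mode: "\<And>t. a < t \<Longrightarrow> t < b \<Longrightarrow> \<forall>\<^sub>F k in sequentially. \<sigma> (t + s k) = \<gamma>"
    and "t \<in> {a..b}"
  shows "y t \<in> slice domf \<gamma>"
proof -
  have "y ` closure {a<..<b} \<subseteq> slice domf \<gamma>"
    using limit_in_slice_open mode by (intro image_closure_subset limit_continuous closed_slice) auto
  then show ?thesis using assms by auto
qed

text \<open>Dominated convergence with the constant bound \<open>speed\<close>: at inner times the
  integrands converge by continuity of \<open>f\<close> on the slice, and passing to the open
  interval discards the ends, where the mode is not known.\<close>

lemma limit_integral:
  assumes "a \<le> b" and mode: "\<And>t. a < t \<Longrightarrow> t < b \<Longrightarrow> \<forall>\<^sub>F k in sequentially. \<sigma> (t + s k) = \<gamma>"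
  shows "((\<lambda>t. f (y t, \<gamma>)) has_integral (y b - y a)) {a..b}"
proof -
  \<comment> \<open>Dropping the first \<open>N\<close> translates makes the bound valid for every
    index on the whole interval.\<close>
  obtain N where N: "\<And>k. k \<ge> N \<Longrightarrow> 0 \<le> a + s k"
    using shift_nonneg[of a] by (auto simp: eventually_sequentially)
  define h where "h k t = f (x (t + s (k + N)), \<sigma> (t + s (k + N)))" for k t
  have h: "(h k has_integral (x (b + s (k + N)) - x (a + s (k + N)))) {a<..<b}" for k
    using velocity_has_integral[of "a + s (k + N)" "b + s (k + N)"] N[of "k + N"] \<open>a \<le> b\<close>
    unfolding has_integral_shift_Icc_real[symmetric] has_integral_Icc_iff_Ioo[symmetric]
    by (simp add: h_def[abs_def] comp_def add.commute)
  have hi: "h k integrable_on {a<..<b}" for k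
    using h by (rule has_integral_integrable)
  have bound: "norm (h k t) \<le> speed" if "t \<in> {a<..<b}" for k t
    unfolding h_def by (rule speed) (use N[of "k + N"] that in auto)
  have conv: "(\<lambda>k. h k t) \<longlonglongrightarrow> f (y t, \<gamma>)" if t: "t \<in> {a<..<b}" for t
  proof -
    have ev: "\<forall>\<^sub>F k in sequentially. \<sigma> (t + s k) = \<gamma>" using mode t by auto
    have "(\<lambda>k. f (x (t + s k), \<gamma>)) \<longlonglongrightarrow> f (y t, \<gamma>)"
    proof (rule continuous_on_tendsto_compose[OF cont_slice x_tendsto limit_in_slice_open[OF ev]])
      show "\<forall>\<^sub>F k in sequentially. x (t + s k) \<in> slice domf \<gamma>"
        using ev shift_nonneg[of t]
        by eventually_elim (use state_in in \<open>auto simp: slice_def\<close>)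
    qed
    moreover have "\<forall>\<^sub>F k in sequentially. f (x (t + s k), \<sigma> (t + s k)) = f (x (t + s k), \<gamma>)"
      using ev by eventually_elim simp
    ultimately have "(\<lambda>k. f (x (t + s k), \<sigma> (t + s k))) \<longlonglongrightarrow> f (y t, \<gamma>)"
      by (simp add: tendsto_cong)
    then show ?thesis unfolding h_def by (rule LIMSEQ_ignore_initial_segment)
  qed
  have const: "(\<lambda>t::real. speed) integrable_on {a<..<b}"
    by (simp add: integrable_on_Icc_iff_Ioo[symmetric] integrable_const_ivl)
  have int: "(\<lambda>t. f (y t, \<gamma>)) integrable_on {a<..<b}"
    by (rule dominated_convergence(1)[of h, OF hi const bound conv])
  have "(\<lambda>k. integral {a<..<b} (h k)) \<longlonglongrightarrow> integral {a<..<b} (\<lambda>t. f (y t, \<gamma>))"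
    by (rule dominated_convergence(2)[of h, OF hi const bound conv])
  moreover have "(\<lambda>k. integral {a<..<b} (h k)) \<longlonglongrightarrow> y b - y a"
    using tendsto_diff[OF x_tendsto[of b] x_tendsto[of a]]
    by (simp add: integral_unique[OF h] LIMSEQ_ignore_initial_segment[of "\<lambda>k. x (b + s k) - x (a + s k)"])
  ultimately have "integral {a<..<b} (\<lambda>t. f (y t, \<gamma>)) = y b - y a"
    by (rule LIMSEQ_unique)
  with int show ?thesis
    by (metis has_integral_Icc_iff_Ioo has_integral_integral)
qed

text \<open>The integrand in \<open>limit_integral\<close> is continuous along \<open>y\<close>, so
  the fundamental theorem gives the derivative at every time, the ends included.\<close>

lemma limit_arc:
  assumes "a < b" and mode: "\<And>t. a < t \<Longrightarrow> t < b \<Longrightarrow> \<forall>\<^sub>F k in sequentially. \<sigma> (t + s k) = \<gamma>"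
  shows "autonomous_arc (slice domf \<gamma>) (\<lambda>\<xi>. f (\<xi>, \<gamma>)) a b y"
  unfolding autonomous_arc_def
proof (intro ballI conjI)
  fix t assume t: "t \<in> {a..b}"
  show "y t \<in> slice domf \<gamma>" using limit_in_slice[OF assms t] .
  have "continuous_on {a..b} (\<lambda>t. f (y t, \<gamma>))"
    by (rule continuous_on_compose2[OF cont_slice limit_continuous]) (use limit_in_slice[OF assms] in auto)
  then have "((\<lambda>u. integral {a..u} (\<lambda>t. f (y t, \<gamma>))) has_vector_derivative f (y t, \<gamma>)) (at t within {a..b})"
    by (rule integral_has_vector_derivative[OF _ t])
  then have "((\<lambda>u. y a + integral {a..u} (\<lambda>t. f (y t, \<gamma>))) has_vector_derivative f (y t, \<gamma>)) (at t within {a..b})"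
    by (auto intro!: derivative_eq_intros)
  then show "(y has_vector_derivative f (y t, \<gamma>)) (at t within {a..b})"
  proof (rule has_vector_derivative_transform[OF t, rotated])
    fix u assume u: "u \<in> {a..b}"
    then have "((\<lambda>t. f (y t, \<gamma>)) has_integral (y u - y a)) {a..u}"
      by (intro limit_integral mode) auto
    then show "y u = y a + integral {a..u} (\<lambda>t. f (y t, \<gamma>))"
      by (simp add: integral_unique)
  qed
qed

end

text \<open>Time is cut into cells of length \<open>\<delta>\<close>, half the dwell time, so that two adjacent cells together
  contain at most one switch. \<open>g i\<close> is the limiting mode at time \<open>i\<delta>\<close> and \<open>p i\<close> the limiting switching
  time in the \<open>i\<close>-th cell; the mode \<open>g i\<close> is thus active from \<open>p (i - 1)\<close> to \<open>p i\<close>. If there is no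
  switch in the \<open>i\<close>-th cell, then \<open>g i = g (i + 1)\<close> and the value of \<open>p i\<close> is immaterial.\<close>

locale mode_limit = trajectory_limit \<Gamma> domf f I x \<sigma> B s y
  for \<Gamma> :: "'g::metric_space set" and domf :: "('a::euclidean_space \<times> 'g) set"
    and f :: "'a \<times> 'g \<Rightarrow> 'a" and I :: "real set" and x :: "real \<Rightarrow> 'a" and \<sigma> :: "real \<Rightarrow> 'g"
    and B :: "'a set" and s :: "nat \<Rightarrow> real" and y :: "real \<Rightarrow> 'a" +
  fixes H :: "'g \<Rightarrow> 'g set" and \<delta> :: real and g :: "int \<Rightarrow> 'g" and p :: "int \<Rightarrow> real"
  assumes \<delta>_pos: "\<delta> > 0"
    and p_ge: "\<And>i. \<delta> * of_int i \<le> p i" and p_le: "\<And>i. p i \<le> \<delta> * of_int (i + 1)"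
    and g_in: "\<And>i. g i \<in> \<Gamma>"
    and edge: "\<And>i. g i \<noteq> g (i + 1) \<Longrightarrow> g (i + 1) \<in> H (g i)"
    and dwell: "\<And>i. g i \<noteq> g (i + 1) \<Longrightarrow> g (i - 1) = g i \<and> g (i + 2) = g (i + 1)"
    and mode: "\<And>i j \<gamma> t. \<lbrakk>i \<le> j; \<And>m. i \<le> m \<Longrightarrow> m \<le> j \<Longrightarrow> g m = \<gamma>; p (i - 1) < t; t < p j\<rbrakk>
      \<Longrightarrow> \<forall>\<^sub>F k in sequentially. \<sigma> (t + s k) = \<gamma>"

text \<open>Each translate switches at most once per cell, so its signal is encoded by one mode and
  one position per cell. These data range over compact sets and have countably many indices, which
  is what a common convergent subsequence requires.\<close>

lemma (in bounded_trajectory) mode_limit_exists: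
  assumes \<sigma>: "\<sigma> \<in> dwell_signals \<Gamma> \<inter> signals_compatible \<Gamma> H" and s: "filterlim s at_top sequentially"
  shows "\<exists>r y \<delta> g p. strict_mono (r :: nat \<Rightarrow> nat) \<and>
    mode_limit \<Gamma> domf f I x \<sigma> B (\<lambda>k. s (r k)) y H \<delta> g p"
proof -
  obtain \<tau> where "\<tau> > 0" and \<tau>: "\<sigma> \<in> signals_with_dwell \<Gamma> \<tau>"
    using \<sigma> by (auto simp: dwell_signals_def)
  define \<delta> where "\<delta> = \<tau> / 2"
  have "\<delta> > 0" "\<delta> < \<tau>" using \<open>\<tau> > 0\<close> by (auto simp: \<delta>_def)
  define G where "G k i = \<sigma> (\<delta> * of_int i + s k)" for k and i :: int
  \<comment> \<open>\<open>q\<close> is the switching position of the \<open>k\<close>-th translate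
    in the cell \<open>i\<close>, in the time of the translate; the last clause makes it a jump as
    soon as the modes at the two ends of the cell differ.\<close>
  define \<Phi> where "\<Phi> k i q \<longleftrightarrow> \<delta> * of_int i < q \<and> q \<le> \<delta> * of_int (i + 1) \<and>
      (\<forall>t. \<delta> * of_int i \<le> t \<and> t < q \<longrightarrow> \<sigma> (t + s k) = G k i) \<and>
      (\<forall>t. q \<le> t \<and> t \<le> \<delta> * of_int (i + 1) \<longrightarrow> \<sigma> (t + s k) = G k (i + 1)) \<and>
      (G k i \<noteq> G k (i + 1) \<longrightarrow> q + s k \<in> jumps \<sigma>)" for k and i :: int and q
  have ex\<Phi>: "\<exists>q. \<Phi> k i q" for k i
  proof -
    obtain q where q: "\<delta> * of_int i + s k < q" "q \<le> \<delta> * of_int i + s k + \<delta>"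
      "\<And>t. \<delta> * of_int i + s k \<le> t \<Longrightarrow> t < q \<Longrightarrow> \<sigma> t = \<sigma> (\<delta> * of_int i + s k)"
      "\<And>t. q \<le> t \<Longrightarrow> t \<le> \<delta> * of_int i + s k + \<delta> \<Longrightarrow> \<sigma> t = \<sigma> (\<delta> * of_int i + s k + \<delta>)"
      "\<sigma> (\<delta> * of_int i + s k) \<noteq> \<sigma> (\<delta> * of_int i + s k + \<delta>) \<Longrightarrow> q \<in> jumps \<sigma>"
      using signals_with_dwell_bin[OF \<tau> \<open>\<delta> > 0\<close> \<open>\<delta> < \<tau>\<close>, of "\<delta> * of_int i + s k"] by blast
    have eq: "\<delta> * of_int i + s k + \<delta> = \<delta> * of_int (i + 1) + s k" by (simp add: algebra_simps)
    have "\<Phi> k i (q - s k)"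
      unfolding \<Phi>_def G_def
    proof (intro conjI allI impI)
      show "\<delta> * of_int i < q - s k" "q - s k \<le> \<delta> * of_int (i + 1)"
        using q(1,2) eq by linarith+
      show "\<sigma> (t + s k) = \<sigma> (\<delta> * of_int i + s k)" if "\<delta> * of_int i \<le> t \<and> t < q - s k" for t
        using q(3)[of "t + s k"] that by simp
      show "\<sigma> (t + s k) = \<sigma> (\<delta> * of_int (i + 1) + s k)" if "q - s k \<le> t \<and> t \<le> \<delta> * of_int (i + 1)" for t
        using q(4)[of "t + s k"] that unfolding eq by linarith
      show "q - s k + s k \<in> jumps \<sigma>" if "\<sigma> (\<delta> * of_int i + s k) \<noteq> \<sigma> (\<delta> * of_int (i + 1) + s k)"
        using q(5) that unfolding eq by simp
    qed
    then show ?thesis ..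
  qed
  define P where "P k i = (SOME q. \<Phi> k i q)" for k i
  have \<Phi>: "\<Phi> k i (P k i)" for k i
    unfolding P_def by (rule someI_ex[OF ex\<Phi>])
  have P: "\<delta> * of_int i < P k i \<and> P k i \<le> \<delta> * of_int (i + 1)" for i k
    using \<Phi>[of k i] by (auto simp: \<Phi>_def)
  have before: "\<sigma> (t + s k) = G k i" if "\<delta> * of_int i \<le> t" "t < P k i" for k i t
    using \<Phi>[of k i] that by (auto simp: \<Phi>_def)
  have after: "\<sigma> (t + s k) = G k (i + 1)" if "P k i \<le> t" "t \<le> \<delta> * of_int (i + 1)" for k i t
    using \<Phi>[of k i] that by (auto simp: \<Phi>_def)
  have jump: "P k i + s k \<in> jumps \<sigma>" if "G k i \<noteq> G k (i + 1)" for k i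
    using \<Phi>[of k i] that by (auto simp: \<Phi>_def)
  have G_edge: "G k (i + 1) \<in> H (G k i)" if "G k i \<noteq> G k (i + 1)" for k i
  proof -
    have "Lim (at_left (P k i + s k)) \<sigma> = G k i"
    proof (rule Lim_at_left_eq)
      fix t assume "\<delta> * of_int i + s k \<le> t" "t < P k i + s k"
      then show "\<sigma> t = G k i" using before[of i "t - s k" k] by simp
    qed (use P[of i k] in simp)
    moreover have "\<sigma> (P k i + s k) = G k (i + 1)" using after P by blast
    ultimately show ?thesis
      using \<sigma> jump[OF that] by (auto simp: signals_compatible_def)
  qed
  \<comment> \<open>The left end of each cell is excluded, so the two positions differ by strictly
    less than \<open>2 * \<delta> = \<tau>\<close>.\<close>
  have no_consecutive: "G k i = G k (i + 1) \<or> G k (i + 1) = G k (i + 2)" for k i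
  proof (rule ccontr)
    assume "\<not> ?thesis"
    then have "P k i + s k \<in> jumps \<sigma>" "P k (i + 1) + s k \<in> jumps \<sigma>"
      using jump[of k i] jump[of k "i + 1"] by (auto simp: add.assoc)
    moreover have "P k i < P k (i + 1)" "P k (i + 1) - P k i < \<tau>"
      using P[of i k] P[of "i + 1" k] by (auto simp: \<delta>_def algebra_simps)
    ultimately show False
      using \<tau> by (fastforce simp: signals_with_dwell_def)
  qed
  have "\<exists>r g p y. strict_mono (r :: nat \<Rightarrow> nat) \<and> (\<forall>i. \<forall>\<^sub>F k in sequentially. G (r k) i = g i) \<and>
      (\<forall>i. (\<lambda>k. P (r k) i) \<longlonglongrightarrow> p i) \<and> (\<forall>q. (\<lambda>k. x (of_rat q + s (r k))) \<longlonglongrightarrow> y q)"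
  proof (rule common_convergent_subsequence[of \<Gamma> G P "\<lambda>i. \<delta> * of_int i" "\<lambda>i. \<delta> * of_int (i + 1)"
        B "\<lambda>k q. x (of_rat q + s k)"])
    show "P k i \<in> {\<delta> * of_int i..\<delta> * of_int (i + 1)}" for k i
      using P[of i k] by auto
    show "\<forall>\<^sub>F k in sequentially. x (of_rat q + s k) \<in> B" for q
    proof -
      have "\<forall>\<^sub>F k in sequentially. - of_rat q \<le> s k"
        using s by (simp add: filterlim_at_top)
      then show ?thesis by eventually_elim (auto intro: state_in_B)
    qed
  qed (use finite_modes compact_B mode_in in \<open>auto simp: G_def\<close>)
  then obtain r :: "nat \<Rightarrow> nat" and g p y0 where r: "strict_mono r"
    and g: "\<And>i. \<forall>\<^sub>F k in sequentially. G (r k) i = g i"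
    and p: "\<And>i. (\<lambda>k. P (r k) i) \<longlonglongrightarrow> p i"
    and y0: "\<And>q. (\<lambda>k. x (of_rat q + s (r k))) \<longlonglongrightarrow> y0 q"
    by blast
  have sr: "filterlim (\<lambda>k. s (r k)) at_top sequentially"
    using filterlim_compose[OF s filterlim_subseq[OF r]] .
  have sr_ge: "\<forall>\<^sub>F k in sequentially. 0 \<le> t + s (r k)" for t
  proof -
    have "\<forall>\<^sub>F k in sequentially. - t \<le> s (r k)"
      using sr by (simp add: filterlim_at_top)
    then show ?thesis by eventually_elim simp
  qed
  define y where "y t = lim (\<lambda>k. x (t + s (r k)))" for t
  have y: "(\<lambda>k. x (t + s (r k))) \<longlonglongrightarrow> y t" for t
    unfolding y_def
  proof (rule tendsto_of_rat_imp_tendsto[of "\<lambda>k t. x (t + s (r k))", OF _ speed(1)])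
    show "convergent (\<lambda>k. x (of_rat q + s (r k)))" for q
      using y0 convergentI by blast
    show "\<forall>\<^sub>F k in sequentially. norm (x (t + s (r k)) - x (u + s (r k))) \<le> speed * \<bar>t - u\<bar>" for t u
      using sr_ge[of t] sr_ge[of u]
      by eventually_elim (use x_lipschitz in fastforce)
  qed
  \<comment> \<open>The strict lower bound on \<open>P k i\<close> becomes weak, so a limiting
    switch may sit on the left end of its cell.\<close>
  have p_ge: "\<delta> * of_int i \<le> p i" and p_le: "p i \<le> \<delta> * of_int (i + 1)" for i
    using P less_imp_le by (blast intro: LIMSEQ_le_const[OF p] LIMSEQ_le_const2[OF p])+
  have ev_ex: "\<exists>k. Q k" if "\<forall>\<^sub>F k in sequentially. Q k" for Q :: "nat \<Rightarrow> bool"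
    using that by (auto simp: eventually_sequentially)
  have "mode_limit \<Gamma> domf f I x \<sigma> B (\<lambda>k. s (r k)) y H \<delta> g p"
  proof unfold_locales
    fix i
    \<comment> \<open>For one large \<open>k\<close> the four modes around \<open>i\<close> agree
      with their limits; the properties of \<open>G (r k)\<close> then pass to
      \<open>g\<close>.\<close>
    have "\<exists>k. G (r k) (i - 1) = g (i - 1) \<and> G (r k) i = g i \<and> G (r k) (i + 1) = g (i + 1)
        \<and> G (r k) (i + 2) = g (i + 2)"
      by (intro ev_ex eventually_conj g)
    then obtain k where k: "G (r k) (i - 1) = g (i - 1)" "G (r k) i = g i" "G (r k) (i + 1) = g (i + 1)"
        "G (r k) (i + 2) = g (i + 2)" by blast
    show "g i \<in> \<Gamma>" using mode_in by (simp add: k(2)[symmetric] G_def)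
    assume ne: "g i \<noteq> g (i + 1)"
    show "g (i + 1) \<in> H (g i)"
      using G_edge[of "r k" i] ne by (simp add: k)
    show "g (i - 1) = g i \<and> g (i + 2) = g (i + 1)"
      using no_consecutive[of "r k" i] no_consecutive[of "r k" "i - 1"] ne
      by (auto simp: k add.commute[of 1])
  next
    fix i j \<gamma> t
    assume ij: "i \<le> j" and \<gamma>: "\<And>m. i \<le> m \<Longrightarrow> m \<le> j \<Longrightarrow> g m = \<gamma>" and t: "p (i - 1) < t" "t < p j"
    \<comment> \<open>\<open>m\<close> is the index of the cell that contains \<open>t\<close>. The
      bounds on \<open>p\<close> leave three positions: the cell \<open>i - 1\<close>, after its
      switch; the cell \<open>j\<close>, before its switch; or a cell with \<open>\<gamma>\<close>
      at both ends, where the position of the switch is immaterial.\<close>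
    define m where "m = \<lfloor>t / \<delta>\<rfloor>"
    have m: "\<delta> * of_int m \<le> t" "t < \<delta> * of_int (m + 1)"
      using floor_divide_lower[OF \<open>\<delta> > 0\<close>, of t] floor_divide_upper[OF \<open>\<delta> > 0\<close>, of t]
      by (auto simp: m_def mult.commute)
    have "\<delta> * of_int (i - 1) < \<delta> * of_int (m + 1)" "\<delta> * of_int m < \<delta> * of_int (j + 1)"
      using m t p_ge[of "i - 1"] p_le[of j] by linarith+
    then have "i - 1 < m + 1" "m < j + 1"
      using \<open>\<delta> > 0\<close> by (metis mult_less_cancel_left_pos of_int_less_iff)+
    then consider "m = i - 1" | "m = j" | "i \<le> m" "m + 1 \<le> j" by linarith
    then show "\<forall>\<^sub>F k in sequentially. \<sigma> (t + s (r k)) = \<gamma>"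
    proof cases
      case 1
      have "\<forall>\<^sub>F k in sequentially. P (r k) (i - 1) < t"
        using order_tendstoD(2)[OF p t(1)] .
      with g[of i] show ?thesis
      proof eventually_elim
        case (elim k)
        then show ?case using after[of "r k" "i - 1" t] m 1 \<gamma>[of i] ij by simp
      qed
    next
      case 2
      have "\<forall>\<^sub>F k in sequentially. t < P (r k) j"
        using order_tendstoD(1)[OF p t(2)] .
      with g[of j] show ?thesis
      proof eventually_elim
        case (elim k)
        then show ?case using before[of j t "r k"] m 2 \<gamma>[of j] ij by simp
      qed
    next
      case 3
      from g[of m] g[of "m + 1"] show ?thesis
      proof eventually_elim
        case (elim k)
        then have "G (r k) m = \<gamma>" "G (r k) (m + 1) = \<gamma>" using \<gamma>[of m] \<gamma>[of "m + 1"] 3 by auto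
        then show ?case using before[of m t "r k"] after[of "r k" m t] m by (cases "t < P (r k) m") auto
      qed
    qed
  qed (use sr y p_ge p_le \<open>\<delta> > 0\<close> in auto)
  then show ?thesis using r by blast
qed

section \<open>Lyapunov functions along the limit\<close>

text \<open>The vector \<open>adjoint D 1\<close> represents the derivative \<open>D\<close>, and
  uniqueness of derivatives identifies it with the description in \<open>gradient\<close>.\<close>

lemma has_derivative_gradient:
  fixes U :: "'a::euclidean_space \<Rightarrow> real"
  assumes "U differentiable (at \<xi>)"
  shows "(U has_derivative (\<lambda>h. h \<bullet> gradient U \<xi>)) (at \<xi>)"
proof -
  obtain D where D: "(U has_derivative D) (at \<xi>)"
    using assms by (auto simp: differentiable_def)
  have "D h = h \<bullet> adjoint D 1" for h
    using adjoint_works[OF has_derivative_linear[OF D], of h 1] by simp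
  then have "D = (\<lambda>h. h \<bullet> adjoint D 1)" by (rule ext)
  with D have ex: "gderiv U \<xi> (adjoint D 1)"
    by (simp add: gderiv_def)
  have uniq: "D1 = D2" if "gderiv U \<xi> D1" "gderiv U \<xi> D2" for D1 D2
  proof -
    have "(\<lambda>h. h \<bullet> D1) = (\<lambda>h. h \<bullet> D2)"
      using that unfolding gderiv_def by (rule has_derivative_unique)
    then show ?thesis by (metis vector_eq_ldot)
  qed
  have "gradient U \<xi> = adjoint D 1"
    unfolding gradient_def using ex by (rule the_equality) (rule uniq[OF _ ex])
  with ex show ?thesis by (simp add: gderiv_def)
qed

text \<open>The chain rule and the constancy of \<open>U\<close> along \<open>y\<close> give two
  derivatives of the same function; because \<open>a < b\<close>, even the one-sided derivatives at
  the ends are unique.\<close>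

lemma gradient_inner_zero_on_level_arc:
  fixes U :: "'a::euclidean_space \<Rightarrow> real"
  assumes arc: "autonomous_arc X F a b y" and "a < b" and t: "t \<in> {a..b}"
    and diff: "U differentiable (at (y t))" and level: "\<And>t. t \<in> {a..b} \<Longrightarrow> U (y t) = c"
  shows "gradient U (y t) \<bullet> F (y t) = 0"
proof -
  have y: "(y has_derivative (\<lambda>h. h *\<^sub>R F (y t))) (at t within {a..b})"
    using arc t by (simp add: autonomous_arc_def has_vector_derivative_def)
  have "((\<lambda>t. U (y t)) has_derivative (\<lambda>h. (h *\<^sub>R F (y t)) \<bullet> gradient U (y t))) (at t within {a..b})"
    by (rule has_derivative_compose[OF y has_derivative_gradient[OF diff]])
  then have "((\<lambda>t. U (y t)) has_vector_derivative (F (y t) \<bullet> gradient U (y t))) (at t within cbox a b)"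
    by (simp add: has_vector_derivative_def)
  moreover have "((\<lambda>t. U (y t)) has_vector_derivative 0) (at t within cbox a b)"
  proof (rule has_vector_derivative_transform)
    show "((\<lambda>t. c) has_vector_derivative 0) (at t within cbox a b)" by (rule has_vector_derivative_const)
  qed (use t level in auto)
  ultimately have "F (y t) \<bullet> gradient U (y t) = 0"
    using vector_derivative_unique_within_closed_interval[OF \<open>a < b\<close>] t by (metis box_real(2))
  then show ?thesis by (simp add: inner_commute)
qed

text \<open>A derivative at interior times is enough: the frontier of an interval is a null set, and
  \<open>is_solution\<close> asks for the equation almost everywhere. The shift by \<open>c\<close>
  moves the chosen time to 0, where \<open>obs_fwd_upto\<close>, \<open>obs_bwd_upto\<close> and
  \<open>unique_zero_solution\<close> prescribe the state.\<close>

lemma autonomous_solution_shift: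
  fixes y :: "real \<Rightarrow> 'a::euclidean_space"
  assumes J: "is_interval J" "J \<noteq> {}"
    and lip: "\<And>t u. norm (y t - y u) \<le> M * \<bar>t - u\<bar>"
    and X: "\<And>t. t \<in> J \<Longrightarrow> y (t + c) \<in> X"
    and deriv: "\<And>t. t \<in> interior J \<Longrightarrow> (y has_vector_derivative F (y (t + c))) (at (t + c))"
  shows "is_autonomous_solution X F J (\<lambda>t. y (t + c))"
  unfolding is_solution_def
proof (intro conjI ballI J X)
  show "locally_abs_continuous_on J (\<lambda>t. y (t + c))"
    unfolding locally_abs_continuous_on_def
    by (intro allI impI lipschitz_imp_abs_continuous_on[of _ _ _ M]) (use lip in \<open>metis add_diff_cancel_right\<close>)
  have "frontier J \<in> null_sets lebesgue"
    using negligible_convex_frontier[OF is_interval_convex[OF J(1)]] by (simp add: negligible_iff_null_sets)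
  then have "AE t in lebesgue. t \<notin> frontier J" by (rule AE_not_in)
  then show "AE t in lebesgue. t \<in> J \<longrightarrow> ((\<lambda>t. y (t + c)) has_vector_derivative F (y (t + c))) (at t within J)"
  proof eventually_elim
    case (elim t)
    show ?case
    proof
      assume "t \<in> J"
      with elim have t: "t \<in> interior J"
        using closure_subset by (auto simp: frontier_def)
      have "((\<lambda>t. t + c) has_vector_derivative 1) (at t)"
        by (auto intro!: derivative_eq_intros)
      from vector_diff_chain_at[OF this deriv[OF t]]
      have "((\<lambda>t. y (t + c)) has_vector_derivative F (y (t + c))) (at t)"
        by (simp add: comp_def)
      then show "((\<lambda>t. y (t + c)) has_vector_derivative F (y (t + c))) (at t within J)"
        by (rule has_vector_derivative_at_within)
    qed
  qed
qed

lemma autonomous_arc_at: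
  assumes "autonomous_arc X F a b y" "a < t" "t < b"
  shows "(y has_vector_derivative F (y t)) (at t)"
proof -
  have "at t within {a..b} = at t"
    by (rule at_within_interior) (use assms in \<open>simp add: interior_atLeastAtMost_real\<close>)
  moreover have "(y has_vector_derivative F (y t)) (at t within {a..b})"
    using assms by (simp add: autonomous_arc_def)
  ultimately show ?thesis by simp
qed

section \<open>Arcs of the limit as autonomous solutions\<close>

context trajectory_limit
begin

text \<open>The arc around \<open>t + c\<close> may vary with \<open>t\<close>, which covers
  half-lines as well as compact intervals. \<open>Y\<close> will be the whole space for the
  uniqueness hypothesis and \<open>proj_dom domV\<close> for the observability sets.\<close>

lemma limit_solution_shift:
  assumes J: "is_interval J" "J \<noteq> {}"
    and arcs: "\<And>t. t \<in> J \<Longrightarrow> \<exists>a b. a \<le> t + c \<and> t + c \<le> b \<and>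
      autonomous_arc (slice domf \<gamma>) (\<lambda>\<xi>. f (\<xi>, \<gamma>)) a b y \<and> (t \<in> interior J \<longrightarrow> a < t + c \<and> t + c < b)"
    and "B \<subseteq> Y"
  shows "is_autonomous_solution (Y \<inter> slice domf \<gamma>) (\<lambda>\<xi>. f (\<xi>, \<gamma>)) J (\<lambda>t. y (t + c))"
proof (rule autonomous_solution_shift[OF J limit_lipschitz])
  fix t assume "t \<in> J"
  then obtain a b where "a \<le> t + c" "t + c \<le> b" "autonomous_arc (slice domf \<gamma>) (\<lambda>\<xi>. f (\<xi>, \<gamma>)) a b y"
    using arcs by blast
  then have "y (t + c) \<in> slice domf \<gamma>" by (simp add: autonomous_arc_def)
  then show "y (t + c) \<in> Y \<inter> slice domf \<gamma>" using limit_in_B \<open>B \<subseteq> Y\<close> by blast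
next
  fix t assume t: "t \<in> interior J"
  then have "t \<in> J" using interior_subset by blast
  then obtain a b where "a < t + c" "t + c < b" "autonomous_arc (slice domf \<gamma>) (\<lambda>\<xi>. f (\<xi>, \<gamma>)) a b y"
    using arcs t by blast
  then show "(y has_vector_derivative f (y (t + c), \<gamma>)) (at (t + c))"
    using autonomous_arc_at by blast
qed

lemma limit_solution_Icc:
  assumes "a < b" and mode: "\<And>t. a < t \<Longrightarrow> t < b \<Longrightarrow> \<forall>\<^sub>F k in sequentially. \<sigma> (t + s k) = \<gamma>"
    and "B \<subseteq> Y"
  shows "is_autonomous_solution (Y \<inter> slice domf \<gamma>) (\<lambda>\<xi>. f (\<xi>, \<gamma>)) {a - c..b - c} (\<lambda>t. y (t + c))"
proof (rule limit_solution_shift[OF _ _ _ \<open>B \<subseteq> Y\<close>])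
  fix t assume "t \<in> {a - c..b - c}"
  then show "\<exists>l r. l \<le> t + c \<and> t + c \<le> r \<and> autonomous_arc (slice domf \<gamma>) (\<lambda>\<xi>. f (\<xi>, \<gamma>)) l r y \<and>
      (t \<in> interior {a - c..b - c} \<longrightarrow> l < t + c \<and> t + c < r)"
    using limit_arc[OF \<open>a < b\<close> mode] by (intro exI[of _ a] exI[of _ b]) (auto simp: interior_atLeastAtMost_real)
qed (use \<open>a < b\<close> in \<open>auto simp: is_interval_cc\<close>)

lemma limit_solution_Ici:
  assumes mode: "\<And>t. a < t \<Longrightarrow> \<forall>\<^sub>F k in sequentially. \<sigma> (t + s k) = \<gamma>" and "B \<subseteq> Y"
  shows "is_autonomous_solution (Y \<inter> slice domf \<gamma>) (\<lambda>\<xi>. f (\<xi>, \<gamma>)) {0..} (\<lambda>t. y (t + a))"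
proof (rule limit_solution_shift[OF _ _ _ \<open>B \<subseteq> Y\<close>])
  fix t :: real assume t: "t \<in> {0..}"
  then show "\<exists>l b. l \<le> t + a \<and> t + a \<le> b \<and> autonomous_arc (slice domf \<gamma>) (\<lambda>\<xi>. f (\<xi>, \<gamma>)) l b y \<and>
      (t \<in> interior {0..} \<longrightarrow> l < t + a \<and> t + a < b)"
    using limit_arc[of a "t + a + 1" \<gamma>] mode
    by (intro exI[of _ a] exI[of _ "t + a + 1"]) (auto simp: interior_real_atLeast)
qed (auto simp: is_interval_ci)

lemma limit_solution_Iic:
  assumes mode: "\<And>t. t < b \<Longrightarrow> \<forall>\<^sub>F k in sequentially. \<sigma> (t + s k) = \<gamma>" and "B \<subseteq> Y"
  shows "is_autonomous_solution (Y \<inter> slice domf \<gamma>) (\<lambda>\<xi>. f (\<xi>, \<gamma>)) {..0} (\<lambda>t. y (t + b))"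
proof (rule limit_solution_shift[OF _ _ _ \<open>B \<subseteq> Y\<close>])
  fix t :: real assume t: "t \<in> {..0}"
  then show "\<exists>a r. a \<le> t + b \<and> t + b \<le> r \<and> autonomous_arc (slice domf \<gamma>) (\<lambda>\<xi>. f (\<xi>, \<gamma>)) a r y \<and>
      (t \<in> interior {..0} \<longrightarrow> a < t + b \<and> t + b < r)"
    using limit_arc[of "t + b - 1" b \<gamma>] mode
    by (intro exI[of _ "t + b - 1"] exI[of _ b]) (auto simp: interior_real_atMost)
qed (auto simp: is_interval_ic)

end

text \<open>\<open>V_tendsto\<close> is a common consequence of the two monotonicity hypotheses on
  \<open>V\<close> along the trajectory. For a mode that \<open>\<sigma>\<close> eventually avoids
  it holds with any value of \<open>C\<close>.\<close>

locale dissipative_limit = mode_limit \<Gamma> domf f I x \<sigma> B s y H \<delta> g p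
  for \<Gamma> :: "'g::metric_space set" and domf :: "('a::euclidean_space \<times> 'g) set"
    and f :: "'a \<times> 'g \<Rightarrow> 'a" and I :: "real set" and x :: "real \<Rightarrow> 'a" and \<sigma> :: "real \<Rightarrow> 'g"
    and B :: "'a set" and s :: "nat \<Rightarrow> real" and y :: "real \<Rightarrow> 'a"
    and H :: "'g \<Rightarrow> 'g set" and \<delta> :: real and g :: "int \<Rightarrow> 'g" and p :: "int \<Rightarrow> real" +
  fixes domV :: "('a \<times> 'g) set" and V :: "'a \<times> 'g \<Rightarrow> real" and W :: "'g \<Rightarrow> 'a \<Rightarrow> real"
    and C :: "'g \<Rightarrow> real"
  assumes class_V: "class_V \<Gamma> domf domV V" and B_sub: "B \<subseteq> proj_dom domV"
    and dissip: "dissipation \<Gamma> domf f domV V W"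
    and V_tendsto: "\<And>\<gamma> \<epsilon>. \<gamma> \<in> \<Gamma> \<Longrightarrow> \<epsilon> > 0 \<Longrightarrow>
      \<forall>\<^sub>F t in at_top. \<sigma> t = \<gamma> \<longrightarrow> \<bar>V (x t, \<gamma>) - C \<gamma>\<bar> < \<epsilon>"
begin

context
  fixes a b \<gamma>
  assumes \<gamma>: "\<gamma> \<in> \<Gamma>" and ab: "a < b"
    and mode_ab: "\<And>t. a < t \<Longrightarrow> t < b \<Longrightarrow> \<forall>\<^sub>F k in sequentially. \<sigma> (t + s k) = \<gamma>"
begin

lemma in_proj_slice: "t \<in> {a..b} \<Longrightarrow> y t \<in> proj_slice domf domV \<gamma>"
  using limit_in_slice[OF ab mode_ab] limit_in_B B_sub by (auto simp: proj_slice_def)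

lemma V_differentiable: "t \<in> {a..b} \<Longrightarrow> (\<lambda>\<eta>. V (\<eta>, \<gamma>)) differentiable (at (y t))"
  using in_proj_slice class_V \<gamma> by (auto simp: class_V_def)

lemma V_limit_open:
  assumes "a < t" "t < b"
  shows "V (y t, \<gamma>) = C \<gamma>"
proof (rule LIMSEQ_unique)
  have "isCont (\<lambda>\<eta>. V (\<eta>, \<gamma>)) (y t)"
    using V_differentiable[of t] assms by (intro differentiable_imp_continuous_within) auto
  then show "(\<lambda>k. V (x (t + s k), \<gamma>)) \<longlonglongrightarrow> V (y t, \<gamma>)"
    using isCont_tendsto_compose[OF _ x_tendsto] by blast
  show "(\<lambda>k. V (x (t + s k), \<gamma>)) \<longlonglongrightarrow> C \<gamma>"
  proof (rule tendstoI)
    fix \<epsilon> :: real assume "\<epsilon> > 0"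
    have "filterlim (\<lambda>k. t + s k) at_top sequentially"
      using s_at_top by (rule filterlim_tendsto_add_at_top[OF tendsto_const])
    then have "\<forall>\<^sub>F k in sequentially. \<sigma> (t + s k) = \<gamma> \<longrightarrow> \<bar>V (x (t + s k), \<gamma>) - C \<gamma>\<bar> < \<epsilon>"
      using V_tendsto[OF \<gamma> \<open>\<epsilon> > 0\<close>] unfolding filterlim_iff by blast
    then show "\<forall>\<^sub>F k in sequentially. dist (V (x (t + s k), \<gamma>)) (C \<gamma>) < \<epsilon>"
      using mode_ab[OF assms] by eventually_elim (simp add: dist_real_def)
  qed
qed

lemma V_limit:
  assumes "t \<in> {a..b}"
  shows "V (y t, \<gamma>) = C \<gamma>"
proof (rule continuous_constant_on_closure[of "{a<..<b}" "\<lambda>t. V (y t, \<gamma>)"])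
  have "isCont (\<lambda>\<eta>. V (\<eta>, \<gamma>)) (y t)" if "t \<in> {a..b}" for t
    using V_differentiable[OF that] by (intro differentiable_imp_continuous_within)
  then have "continuous_on (y ` {a..b}) (\<lambda>\<eta>. V (\<eta>, \<gamma>))"
    by (auto intro: continuous_at_imp_continuous_on)
  then show "continuous_on (closure {a<..<b}) (\<lambda>t. V (y t, \<gamma>))"
    using ab by (auto intro: continuous_on_compose2[OF _ limit_continuous])
qed (use V_limit_open assms ab in auto)

lemma W_limit:
  assumes "t \<in> {a..b}"
  shows "W \<gamma> (y t) = 0"
proof -
  have "gradient (\<lambda>\<eta>. V (\<eta>, \<gamma>)) (y t) \<bullet> f (y t, \<gamma>) = 0"
    using V_differentiable[OF assms] V_limit
    by (intro gradient_inner_zero_on_level_arc[OF limit_arc[OF ab mode_ab] ab assms]) auto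
  then show ?thesis
    using dissip in_proj_slice[OF assms] \<gamma> unfolding dissipation_def by force
qed

lemma level_limit: "t \<in> {a..b} \<Longrightarrow> y t \<in> {\<xi> \<in> slice domV \<gamma>. V (\<xi>, \<gamma>) = C \<gamma>}"
  using V_limit[of t] in_proj_slice[of t] class_V \<gamma> unfolding class_V_def by blast

lemma limit_in_obs_fwd: "y a \<in> obs_fwd (proj_slice domf domV \<gamma>) (\<lambda>\<xi>. f (\<xi>, \<gamma>)) (W \<gamma>)"
proof -
  \<comment> \<open>Written with \<open>a - a\<close> to match \<open>limit_solution_Icc\<close> for
    \<open>c = a\<close>.\<close>
  have "{t. 0 \<le> t \<and> ereal t \<le> ereal (b - a)} = {a - a..b - a}" by auto
  then have "y a \<in> obs_fwd_upto (proj_slice domf domV \<gamma>) (\<lambda>\<xi>. f (\<xi>, \<gamma>)) (W \<gamma>) (ereal (b - a))"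
    using limit_solution_Icc[OF ab mode_ab B_sub, of a] W_limit in_proj_slice[of a] ab
    unfolding obs_fwd_upto_def by (auto simp: proj_slice_def intro!: exI[of _ "\<lambda>t. y (t + a)"])
  then show ?thesis using ab by (auto simp: obs_fwd_def intro!: bexI[of _ "b - a"])
qed

lemma limit_in_obs_bwd: "y b \<in> obs_bwd (proj_slice domf domV \<gamma>) (\<lambda>\<xi>. f (\<xi>, \<gamma>)) (W \<gamma>)"
proof -
  have "{t. - ereal (b - a) \<le> ereal t \<and> t \<le> 0} = {a - b..b - b}" by auto
  then have "y b \<in> obs_bwd_upto (proj_slice domf domV \<gamma>) (\<lambda>\<xi>. f (\<xi>, \<gamma>)) (W \<gamma>) (ereal (b - a))"
    using limit_solution_Icc[OF ab mode_ab B_sub, of b] W_limit in_proj_slice[of b] ab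
    unfolding obs_bwd_upto_def by (auto simp: proj_slice_def intro!: exI[of _ "\<lambda>t. y (t + b)"])
  then show ?thesis using ab by (auto simp: obs_bwd_def intro!: bexI[of _ "b - a"])
qed

end

lemma limit_in_obs_fwd_infinity:
  assumes \<gamma>: "\<gamma> \<in> \<Gamma>" and mode_a: "\<And>t. a < t \<Longrightarrow> \<forall>\<^sub>F k in sequentially. \<sigma> (t + s k) = \<gamma>"
  shows "y a \<in> obs_fwd_upto (proj_slice domf domV \<gamma>) (\<lambda>\<xi>. f (\<xi>, \<gamma>)) (W \<gamma>) \<infinity>"
proof -
  \<comment> \<open>Compact intervals suffice: each such \<open>t\<close> lies in
    \<open>{a..t + 1}\<close>.\<close>
  have "y t \<in> proj_slice domf domV \<gamma>" "W \<gamma> (y t) = 0" if "a \<le> t" for t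
    using in_proj_slice[OF \<gamma>, of a "t + 1"] W_limit[OF \<gamma>, of a "t + 1"] mode_a that by auto
  moreover have "{t::real. 0 \<le> t \<and> ereal t \<le> \<infinity>} = {0..}" by auto
  ultimately show ?thesis
    using limit_solution_Ici[OF mode_a B_sub]
    unfolding obs_fwd_upto_def by (auto simp: proj_slice_def intro!: exI[of _ "\<lambda>t. y (t + a)"])
qed

lemma limit_in_obs_bwd_infinity:
  assumes \<gamma>: "\<gamma> \<in> \<Gamma>" and mode_b: "\<And>t. t < b \<Longrightarrow> \<forall>\<^sub>F k in sequentially. \<sigma> (t + s k) = \<gamma>"
  shows "y b \<in> obs_bwd_upto (proj_slice domf domV \<gamma>) (\<lambda>\<xi>. f (\<xi>, \<gamma>)) (W \<gamma>) \<infinity>"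
proof -
  have "y t \<in> proj_slice domf domV \<gamma>" "W \<gamma> (y t) = 0" if "t \<le> b" for t
    using in_proj_slice[OF \<gamma>, of "t - 1" b] W_limit[OF \<gamma>, of "t - 1" b] mode_b that by auto
  moreover have "{t::real. - \<infinity> \<le> ereal t \<and> t \<le> 0} = {..0}" by auto
  ultimately show ?thesis
    using limit_solution_Iic[OF mode_b B_sub]
    unfolding obs_bwd_upto_def by (auto simp: proj_slice_def intro!: exI[of _ "\<lambda>t. y (t + b)"])
qed

end

section \<open>Propagation of zeros; modes far ahead and far behind\<close>

context mode_limit
begin

lemma cell_exists: "\<exists>i. t \<in> {p (i - 1)..p i}"
proof -
  define m where "m = \<lfloor>t / \<delta>\<rfloor>"
  have m: "\<delta> * of_int m \<le> t" "t < \<delta> * of_int (m + 1)"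
    using floor_divide_lower[OF \<delta>_pos, of t] floor_divide_upper[OF \<delta>_pos, of t]
    by (auto simp: m_def mult.commute)
  show ?thesis
  proof (cases "t \<le> p m")
    case True
    then show ?thesis using m p_le[of "m - 1"] by (intro exI[of _ m]) auto
  next
    case False
    then show ?thesis using m p_ge[of "m + 1"] by (intro exI[of _ "m + 1"]) auto
  qed
qed

text \<open>Uniqueness acts in both directions of time on an interval
  \<open>{p (i - 1)..p i}\<close>, where a single mode is active. Neighbouring intervals share an
  end point, so the zero spreads by induction over the integers.\<close>

lemma limit_zero_propagates:
  assumes uniq: "\<And>\<gamma>. \<gamma> \<in> \<Gamma> \<Longrightarrow> 0 \<in> slice domf \<gamma> \<Longrightarrow> unique_zero_solution (slice domf \<gamma>) (\<lambda>\<xi>. f (\<xi>, \<gamma>))"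
    and zero: "y t0 = 0"
  shows "y t = 0"
proof -
  define Z where "Z i \<longleftrightarrow> (\<forall>t\<in>{p (i - 1)..p i}. y t = 0)" for i
  have cell: "Z i" if t1: "t1 \<in> {p (i - 1)..p i}" and z: "y t1 = 0" for i t1
  proof (cases "p (i - 1) < p i")
    \<comment> \<open>The interval shrinks to a point when both switching times fall on
      \<open>\<delta> * of_int i\<close>.\<close>
    case False
    then have "{p (i - 1)..p i} \<subseteq> {t1}" using t1 by auto
    then show ?thesis using z unfolding Z_def by blast
  next
    case True
    have mode_i: "\<forall>\<^sub>F k in sequentially. \<sigma> (t + s k) = g i" if "p (i - 1) < t" "t < p i" for t
    proof (rule mode[of i i])
      show "g m = g i" if "i \<le> m" "m \<le> i" for m using that by simp
    qed (use that in auto)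
    have "0 \<in> slice domf (g i)"
      using limit_in_slice[OF True mode_i t1] z by simp
    then have "unique_zero_solution (slice domf (g i)) (\<lambda>\<xi>. f (\<xi>, g i))"
      using uniq g_in by blast
    moreover have "is_autonomous_solution (slice domf (g i)) (\<lambda>\<xi>. f (\<xi>, g i)) {p (i - 1) - t1..p i - t1} (\<lambda>t. y (t + t1))"
      using limit_solution_Icc[OF True mode_i subset_UNIV, of t1] by simp
    moreover have "0 \<in> {p (i - 1) - t1..p i - t1}" "y (0 + t1) = 0" using t1 z by auto
    ultimately have *: "\<forall>t\<in>{p (i - 1) - t1..p i - t1}. y (t + t1) = 0"
      unfolding unique_zero_solution_def by blast
    show ?thesis unfolding Z_def
    proof
      fix t assume "t \<in> {p (i - 1)..p i}"
      then show "y t = 0" using bspec[OF *, of "t - t1"] by simp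
    qed
  qed
  have p_mono: "p (i - 1) \<le> p i" for i
    using p_le[of "i - 1"] p_ge[of i] by simp
  obtain i0 where "t0 \<in> {p (i0 - 1)..p i0}" using cell_exists by blast
  with zero have "Z i0" using cell by blast
  then have "Z i" for i
  proof (induction i rule: int_induct[where k = i0])
    case (step1 i)
    then have "y (p i) = 0" using p_mono[of i] by (auto simp: Z_def)
    then show ?case using cell[of "p i" "i + 1"] p_mono[of "i + 1"] by simp
  next
    case (step2 i)
    then have "y (p (i - 1)) = 0" using p_mono[of i] by (auto simp: Z_def)
    then show ?case using cell[of "p (i - 1)" "i - 1"] p_mono[of "i - 1"] by simp
  qed
  then show ?thesis using cell_exists[of t] by (auto simp: Z_def)
qed

lemma mode_ahead:
  assumes const: "\<And>m. i \<le> m \<Longrightarrow> g m = \<gamma>" and t: "p (i - 1) < t"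
  shows "\<forall>\<^sub>F k in sequentially. \<sigma> (t + s k) = \<gamma>"
proof -
  \<comment> \<open>\<open>mode\<close> wants a last index \<open>j\<close>; one with
    \<open>t < \<delta> * of_int j\<close> will do, as the right-hand side is at most
    \<open>p j\<close>.\<close>
  define j where "j = max i (\<lfloor>t / \<delta>\<rfloor> + 1)"
  have "t < \<delta> * of_int (\<lfloor>t / \<delta>\<rfloor> + 1)"
    using floor_divide_upper[OF \<delta>_pos, of t] by (simp add: mult.commute)
  also have "\<dots> \<le> \<delta> * of_int j" using \<delta>_pos by (intro mult_left_mono) (auto simp: j_def)
  also have "\<dots> \<le> p j" by (rule p_ge)
  finally show ?thesis using mode[of i j \<gamma> t] const t by (auto simp: j_def)
qed

lemma mode_behind:
  assumes const: "\<And>m. m \<le> j \<Longrightarrow> g m = \<gamma>" and t: "t < p j"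
  shows "\<forall>\<^sub>F k in sequentially. \<sigma> (t + s k) = \<gamma>"
proof -
  \<comment> \<open>Here \<open>p (i - 1)\<close> is at most \<open>\<delta> * of_int i\<close>;
    subtracting 1 makes the latter strictly less than \<open>t\<close>.\<close>
  define i where "i = min j (\<lfloor>t / \<delta>\<rfloor> - 1)"
  have "p (i - 1) \<le> \<delta> * of_int i" using p_le[of "i - 1"] by simp
  also have "\<dots> \<le> \<delta> * of_int (\<lfloor>t / \<delta>\<rfloor> - 1)"
    using \<delta>_pos by (intro mult_left_mono) (auto simp: i_def)
  also have "\<dots> < t"
    using floor_divide_lower[OF \<delta>_pos, of t] \<delta>_pos by (simp add: algebra_simps)
  finally show ?thesis using mode[of i j \<gamma> t] const t by (auto simp: i_def)
qed

end

context dissipative_limit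
begin

abbreviation "Obs_fwd \<gamma> \<equiv> obs_fwd (proj_slice domf domV \<gamma>) (\<lambda>\<xi>. f (\<xi>, \<gamma>)) (W \<gamma>)"
abbreviation "Obs_bwd \<gamma> \<equiv> obs_bwd (proj_slice domf domV \<gamma>) (\<lambda>\<xi>. f (\<xi>, \<gamma>)) (W \<gamma>)"
abbreviation "Level \<gamma> \<equiv> {\<xi> \<in> slice domV \<gamma>. V (\<xi>, \<gamma>) = C \<gamma>}"

text \<open>The observability sets need a positive duration before and after the switch, but
  \<open>{p (i - 1)..p i}\<close> may be a single point. By \<open>dwell\<close> the mode
  \<open>g i\<close> is already active from \<open>p (i - 2)\<close> on and \<open>g (i + 1)\<close>
  lasts until \<open>p (i + 2)\<close>, and both intervals have length at least
  \<open>\<delta>\<close>.\<close>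

lemma switch_in_obs:
  assumes ne: "g i \<noteq> g (i + 1)"
  shows "y (p i) \<in> Obs_bwd (g i) \<inter> Obs_fwd (g (i + 1)) \<inter> Level (g i) \<inter> Level (g (i + 1))"
proof -
  have gm: "g m = g i" if "i - 1 \<le> m" "m \<le> i" for m
  proof -
    have "m = i - 1 \<or> m = i" using that by auto
    then show ?thesis using dwell[OF ne] by auto
  qed
  have gm': "g m = g (i + 1)" if "i + 1 \<le> m" "m \<le> i + 2" for m
  proof -
    have "m = i + 1 \<or> m = i + 2" using that by auto
    then show ?thesis using dwell[OF ne] by auto
  qed
  have lt: "p (i - 2) < p i" "p i < p (i + 2)"
    using p_le[of "i - 2"] p_ge[of i] p_le[of i] p_ge[of "i + 2"] \<delta>_pos
    by (auto simp: algebra_simps)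
  have before: "\<forall>\<^sub>F k in sequentially. \<sigma> (t + s k) = g i" if t: "p (i - 2) < t" "t < p i" for t
  proof (rule mode[of "i - 1" i])
    show "g m = g i" if "i - 1 \<le> m" "m \<le> i" for m using that by (rule gm)
  qed (use t in auto)
  have after: "\<forall>\<^sub>F k in sequentially. \<sigma> (t + s k) = g (i + 1)" if t: "p i < t" "t < p (i + 2)" for t
  proof (rule mode[of "i + 1" "i + 2"])
    show "g m = g (i + 1)" if "i + 1 \<le> m" "m \<le> i + 2" for m using that by (rule gm')
  qed (use t in auto)
  have "p i \<in> {p (i - 2)..p i}" "p i \<in> {p i..p (i + 2)}" using lt by auto
  then show ?thesis
    by (intro IntI limit_in_obs_bwd[OF g_in lt(1) before] limit_in_obs_fwd[OF g_in lt(2) after]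
      level_limit[OF g_in lt(1) before] level_limit[OF g_in lt(2) after])
qed

lemma limit_zero:
  assumes uniq: "\<And>\<gamma>. \<gamma> \<in> \<Gamma> \<Longrightarrow> 0 \<in> slice domf \<gamma> \<Longrightarrow> unique_zero_solution (slice domf \<gamma>) (\<lambda>\<xi>. f (\<xi>, \<gamma>))"
    and inv: "(\<forall>\<gamma>\<in>\<Gamma>. obs_fwd_upto (proj_slice domf domV \<gamma>) (\<lambda>\<xi>. f (\<xi>, \<gamma>)) (W \<gamma>) \<infinity> \<subseteq> {0}) \<or>
      (\<forall>\<gamma>\<in>\<Gamma>. obs_bwd_upto (proj_slice domf domV \<gamma>) (\<lambda>\<xi>. f (\<xi>, \<gamma>)) (W \<gamma>) \<infinity> \<subseteq> {0})"
    and cyc: "\<And>m c. simple_cycle \<Gamma> H m c \<Longrightarrow>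
      \<exists>j\<in>{1..m-1}. Obs_bwd (c j) \<inter> Obs_fwd (c (j+1)) \<inter> Level (c j) \<inter> Level (c (j+1)) \<subseteq> {0}"
  shows "y t = 0"
proof -
  define E where "E = {(g i, g (i + 1)) |i. g i \<noteq> g (i + 1)}"
  have E_I: "(g i, g (i + 1)) \<in> E" if "g i \<noteq> g (i + 1)" for i
    using that unfolding E_def by (intro CollectI exI[of _ i] conjI refl)
  have "\<exists>t0. y t0 = 0"
  proof (cases "acyclic E")
    case False
    have "irrefl E" by (auto simp: E_def irrefl_def)
    moreover have "\<gamma> \<in> \<Gamma> \<and> \<gamma>' \<in> H \<gamma>" if "(\<gamma>, \<gamma>') \<in> E" for \<gamma> \<gamma>'
      using that edge g_in by (auto simp: E_def)
    ultimately have "\<exists>m c. simple_cycle \<Gamma> H m c \<and> (\<forall>j\<in>{1..m-1}. (c j, c (j + 1)) \<in> E)"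
      by (rule simple_cycle_of_cyclic[OF False])
    then obtain m c where mc: "simple_cycle \<Gamma> H m c" "\<And>j. j \<in> {1..m-1} \<Longrightarrow> (c j, c (j + 1)) \<in> E"
      by blast
    obtain j where j: "j \<in> {1..m-1}"
      "Obs_bwd (c j) \<inter> Obs_fwd (c (j+1)) \<inter> Level (c j) \<inter> Level (c (j+1)) \<subseteq> {0}"
      using cyc[OF mc(1)] by blast
    \<comment> \<open>Every edge in \<open>E\<close> is a switch of the limit, so \<open>j\<close>
      supplies a switching time \<open>p i\<close>, whether or not the signal runs through the cycle
      in its order.\<close>
    obtain i where i: "c j = g i" "c (j + 1) = g (i + 1)" "g i \<noteq> g (i + 1)"
      using mc(2)[OF j(1)] by (auto simp: E_def)
    show ?thesis using switch_in_obs[OF i(3)] j(2) unfolding i(1,2) by blast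
  next
    case True
    have "E \<subseteq> \<Gamma> \<times> \<Gamma>" using g_in by (auto simp: E_def)
    then have "finite E" using finite_modes finite_subset by blast
    \<comment> \<open>The sequence \<open>g (int n)\<close> moves along \<open>E\<close>, and
      \<open>g (- int n)\<close> along its converse; each direction of time uses one of the two
      facts.\<close>
    with True have wf: "wf (E\<inverse>)" "wf ((E\<inverse>)\<inverse>)"
      using finite_acyclic_wf_converse finite_acyclic_wf by auto
    from inv show ?thesis
    proof
      assume fwd: "\<forall>\<gamma>\<in>\<Gamma>. obs_fwd_upto (proj_slice domf domV \<gamma>) (\<lambda>\<xi>. f (\<xi>, \<gamma>)) (W \<gamma>) \<infinity> \<subseteq> {0}"
      have "\<exists>N. \<forall>n\<ge>N. g (int n) = g (int N)"
      proof (rule wf_converse_eventually_constant[OF wf(1)])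
        fix n assume "g (int n) \<noteq> g (int (Suc n))"
        moreover have eq: "int (Suc n) = int n + 1" by simp
        ultimately show "(g (int n), g (int (Suc n))) \<in> E" unfolding eq by (intro E_I)
      qed
      then obtain N where N: "\<And>n. n \<ge> N \<Longrightarrow> g (int n) = g (int N)" by blast
      have const: "g m = g (int N)" if "int N \<le> m" for m
        using N[of "nat m"] that by simp
      have "y (p (int N - 1)) \<in> obs_fwd_upto (proj_slice domf domV (g (int N))) (\<lambda>\<xi>. f (\<xi>, g (int N))) (W (g (int N))) \<infinity>"
      proof (rule limit_in_obs_fwd_infinity[OF g_in])
        fix t assume "p (int N - 1) < t"
        then show "\<forall>\<^sub>F k in sequentially. \<sigma> (t + s k) = g (int N)"
          by (rule mode_ahead[rotated]) (rule const)
      qed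
      then show ?thesis using fwd g_in by blast
    next
      assume bwd: "\<forall>\<gamma>\<in>\<Gamma>. obs_bwd_upto (proj_slice domf domV \<gamma>) (\<lambda>\<xi>. f (\<xi>, \<gamma>)) (W \<gamma>) \<infinity> \<subseteq> {0}"
      have "\<exists>N. \<forall>n\<ge>N. g (- int n) = g (- int N)"
      proof (rule wf_converse_eventually_constant[OF wf(2)])
        fix n assume ne: "g (- int n) \<noteq> g (- int (Suc n))"
        have eq: "- int n = - int (Suc n) + 1" by simp
        from ne have "g (- int (Suc n)) \<noteq> g (- int (Suc n) + 1)"
          unfolding eq[symmetric] by (rule not_sym)
        from E_I[OF this] show "(g (- int n), g (- int (Suc n))) \<in> E\<inverse>"
          unfolding eq[symmetric] by (rule converseI)
      qed
      then obtain N where N: "\<And>n. n \<ge> N \<Longrightarrow> g (- int n) = g (- int N)" by blast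
      have const: "g m = g (- int N)" if "m \<le> - int N" for m
        using N[of "nat (- m)"] that by simp
      have "y (p (- int N)) \<in> obs_bwd_upto (proj_slice domf domV (g (- int N))) (\<lambda>\<xi>. f (\<xi>, g (- int N))) (W (g (- int N))) \<infinity>"
      proof (rule limit_in_obs_bwd_infinity[OF g_in])
        fix t assume "t < p (- int N)"
        then show "\<forall>\<^sub>F k in sequentially. \<sigma> (t + s k) = g (- int N)"
          by (rule mode_behind[rotated]) (rule const)
      qed
      then show ?thesis using bwd g_in by blast
    qed
  qed
  then obtain t0 where "y t0 = 0" ..
  then show ?thesis by (rule limit_zero_propagates[rotated]) (rule uniq)
qed

end

section \<open>Convergence\<close>

text \<open>One time \<open>t0\<close> in \<open>A\<close> at which \<open>v\<close> is within
  \<open>\<epsilon>\<close> of its infimum confines all later values on \<open>A\<close>.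
  Restricting the conclusion to \<open>A\<close> keeps it true, vacuously at large times, when
  \<open>A\<close> is bounded or empty.\<close>

lemma antimono_on_eventually_near_Inf:
  fixes v :: "real \<Rightarrow> real"
  assumes mono: "antimono_on A v" and bdd: "bdd_below (v ` A)" and "\<epsilon> > 0"
  shows "\<forall>\<^sub>F t in at_top. t \<in> A \<longrightarrow> \<bar>v t - Inf (v ` A)\<bar> < \<epsilon>"
proof (cases "A = {}")
  case False
  then obtain t0 where t0: "t0 \<in> A" "v t0 < Inf (v ` A) + \<epsilon>"
    using cInf_lessD[of "v ` A" "Inf (v ` A) + \<epsilon>"] \<open>\<epsilon> > 0\<close> by auto
  show ?thesis
    using eventually_ge_at_top[of t0]
  proof eventually_elim
    case (elim t)
    show ?case
    proof
      assume "t \<in> A"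
      then have "v t \<le> v t0" using mono t0(1) elim by (auto simp: monotone_on_def)
      moreover have "Inf (v ` A) \<le> v t" using bdd \<open>t \<in> A\<close> by (intro cInf_lower) auto
      ultimately show "\<bar>v t - Inf (v ` A)\<bar> < \<epsilon>" using t0(2) by auto
    qed
  qed
qed auto

context bounded_trajectory
begin

text \<open>In a fixed mode, \<open>V\<close> is continuous on the compact set of states of
  \<open>B\<close> admissible for that mode, and there are finitely many modes.\<close>

lemma V_bdd_below:
  assumes "class_V \<Gamma> domf domV V" and "B \<subseteq> proj_dom domV"
  shows "bdd_below ((\<lambda>t. V (x t, \<sigma> t)) ` {0..})"
proof -
  have "bdd_below ((\<lambda>\<xi>. V (\<xi>, \<gamma>)) ` (B \<inter> slice domf \<gamma>))" if "\<gamma> \<in> \<Gamma>" for \<gamma>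
  proof -
    have "isCont (\<lambda>\<xi>. V (\<xi>, \<gamma>)) \<xi>" if "\<xi> \<in> B \<inter> slice domf \<gamma>" for \<xi>
      using assms that \<open>\<gamma> \<in> \<Gamma>\<close>
      by (intro differentiable_imp_continuous_within) (auto simp: class_V_def proj_slice_def)
    then have "continuous_on (B \<inter> slice domf \<gamma>) (\<lambda>\<xi>. V (\<xi>, \<gamma>))"
      by (auto intro: continuous_at_imp_continuous_on)
    moreover have "compact (B \<inter> slice domf \<gamma>)"
      by (intro compact_Int_closed compact_B closed_slice)
    ultimately show ?thesis
      by (intro bounded_imp_bdd_below compact_imp_bounded compact_continuous_image)
  qed
  then have "bdd_below (\<Union>\<gamma>\<in>\<Gamma>. (\<lambda>\<xi>. V (\<xi>, \<gamma>)) ` (B \<inter> slice domf \<gamma>))"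
    using finite_modes by (simp add: bdd_below_UN)
  then show ?thesis
    by (rule bdd_below_mono) (use state_in state_in_B mode_in in \<open>fastforce simp: slice_def\<close>)
qed

text \<open>Leaving \<open>C\<close> open lets one proof serve both parts: what enters is the
  convergence of \<open>V\<close> mode by mode and a cycle condition restricted to the levels
  \<open>C\<close>.\<close>

lemma tendsto_zero:
  assumes \<sigma>: "\<sigma> \<in> dwell_signals \<Gamma> \<inter> signals_compatible \<Gamma> H"
    and uniq: "\<And>\<gamma>. \<gamma> \<in> \<Gamma> \<Longrightarrow> 0 \<in> slice domf \<gamma> \<Longrightarrow> unique_zero_solution (slice domf \<gamma>) (\<lambda>\<xi>. f (\<xi>, \<gamma>))"
    and class_V: "class_V \<Gamma> domf domV V" and B_sub: "B \<subseteq> proj_dom domV"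
    and dissip: "dissipation \<Gamma> domf f domV V W"
    and V_tendsto: "\<And>\<gamma> \<epsilon>. \<gamma> \<in> \<Gamma> \<Longrightarrow> \<epsilon> > 0 \<Longrightarrow>
      \<forall>\<^sub>F t in at_top. \<sigma> t = \<gamma> \<longrightarrow> \<bar>V (x t, \<gamma>) - C \<gamma>\<bar> < \<epsilon>"
    and inv: "(\<forall>\<gamma>\<in>\<Gamma>. obs_fwd_upto (proj_slice domf domV \<gamma>) (\<lambda>\<xi>. f (\<xi>, \<gamma>)) (W \<gamma>) \<infinity> \<subseteq> {0}) \<or>
      (\<forall>\<gamma>\<in>\<Gamma>. obs_bwd_upto (proj_slice domf domV \<gamma>) (\<lambda>\<xi>. f (\<xi>, \<gamma>)) (W \<gamma>) \<infinity> \<subseteq> {0})"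
    and cyc: "\<And>m c. simple_cycle \<Gamma> H m c \<Longrightarrow> \<exists>j\<in>{1..m-1}.
        obs_bwd (proj_slice domf domV (c j)) (\<lambda>\<xi>. f (\<xi>, c j)) (W (c j)) \<inter>
        obs_fwd (proj_slice domf domV (c (j+1))) (\<lambda>\<xi>. f (\<xi>, c (j+1))) (W (c (j+1))) \<inter>
        {\<xi> \<in> slice domV (c j). V (\<xi>, c j) = C (c j)} \<inter>
        {\<xi> \<in> slice domV (c (j+1)). V (\<xi>, c (j+1)) = C (c (j+1))} \<subseteq> {0}"
  shows "(x \<longlongrightarrow> 0) at_top"
proof (rule ccontr)
  assume "\<not> ?thesis"
  then obtain \<epsilon> where "\<epsilon> > 0" and \<epsilon>: "\<not> (\<forall>\<^sub>F t in at_top. dist (x t) 0 < \<epsilon>)"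
    unfolding tendsto_iff by blast
  have "\<forall>k::nat. \<exists>t. real k \<le> t \<and> \<epsilon> \<le> norm (x t)"
    using \<epsilon> by (auto simp: eventually_at_top_linorder not_less)
  then obtain s where s: "\<And>k::nat. real k \<le> s k" "\<And>k. \<epsilon> \<le> norm (x (s k))"
    using choice[of "\<lambda>k t. real k \<le> t \<and> \<epsilon> \<le> norm (x t)"] by blast
  have "filterlim s at_top sequentially"
    by (rule filterlim_at_top_mono[OF filterlim_real_sequentially]) (simp add: s)
  then obtain r :: "nat \<Rightarrow> nat" and y \<delta> g p where "mode_limit \<Gamma> domf f I x \<sigma> B (\<lambda>k. s (r k)) y H \<delta> g p"
    using mode_limit_exists[OF \<sigma>] by blast
  then interpret L: dissipative_limit \<Gamma> domf f I x \<sigma> B "\<lambda>k. s (r k)" y H \<delta> g p domV V W C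
    by (intro dissipative_limit.intro dissipative_limit_axioms.intro class_V B_sub dissip V_tendsto)
  \<comment> \<open>At time 0 the translates take the values \<open>x (s (r k))\<close>, of norm at
    least \<open>\<epsilon>\<close>.\<close>
  have "y 0 = 0"
    by (rule L.limit_zero[OF _ inv]) (use uniq cyc in blast)+
  then have "(\<lambda>k. norm (x (0 + s (r k)))) \<longlonglongrightarrow> 0"
    using tendsto_norm_zero[OF L.x_tendsto[of 0, unfolded \<open>y 0 = 0\<close>]] by simp
  then have "\<forall>\<^sub>F k in sequentially. norm (x (0 + s (r k))) < \<epsilon>"
    using \<open>\<epsilon> > 0\<close> by (rule order_tendstoD)
  then obtain k where "norm (x (s (r k))) < \<epsilon>"
    by (auto simp: eventually_sequentially)
  with s(2)[of "r k"] show False by simp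
qed

end

theorem theorem4p4:
  fixes \<Gamma> :: "'g::metric_space set"
    and domf :: "((real ^ 'n) \<times> 'g) set"
    and f :: "(real ^ 'n) \<times> 'g \<Rightarrow> real ^ 'n"
    and H :: "'g \<Rightarrow> 'g set"
    and I :: "real set"
    and x :: "real \<Rightarrow> real ^ 'n"
    and \<sigma> :: "real \<Rightarrow> 'g"
  assumes "finite \<Gamma>"
    and "domf \<subseteq> UNIV \<times> \<Gamma>" and "closed domf" and "continuous_on domf f"
    and "\<forall>\<gamma>\<in>\<Gamma>. H \<gamma> \<subseteq> \<Gamma>"
    and "trajectory \<Gamma> domf f I x \<sigma>" and "forward_complete I"
    and "\<sigma> \<in> dwell_signals \<Gamma> \<inter> signals_compatible \<Gamma> H"
    and "\<forall>\<gamma>\<in>\<Gamma>. 0 \<in> slice domf \<gamma> \<longrightarrow> f (0, \<gamma>) = 0"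
    and "\<forall>\<gamma>\<in>\<Gamma>. 0 \<in> slice domf \<gamma> \<longrightarrow> unique_zero_solution (slice domf \<gamma>) (\<lambda>\<xi>. f (\<xi>, \<gamma>))"
  shows
    "((\<exists>(domV :: ((real ^ 'n) \<times> 'g) set) (V :: (real ^ 'n) \<times> 'g \<Rightarrow> real)
        (W :: 'g \<Rightarrow> real ^ 'n \<Rightarrow> real).
        class_V \<Gamma> domf domV V \<and>
        precompact_relative I x (proj_dom domV) \<and>
        (\<forall>\<gamma>\<in>\<Gamma>. antimono_on (\<sigma> -` {\<gamma>} \<inter> {0..}) (\<lambda>t. V (x t, \<sigma> t))) \<and>
        dissipation \<Gamma> domf f domV V W \<and>
        0 \<in> proj_dom domV \<and>
        ((\<forall>\<gamma>\<in>\<Gamma>. obs_fwd_upto (proj_slice domf domV \<gamma>) (\<lambda>\<xi>. f (\<xi>, \<gamma>)) (W \<gamma>) \<infinity> \<subseteq> {0}) \<or>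
         (\<forall>\<gamma>\<in>\<Gamma>. obs_bwd_upto (proj_slice domf domV \<gamma>) (\<lambda>\<xi>. f (\<xi>, \<gamma>)) (W \<gamma>) \<infinity> \<subseteq> {0})) \<and>
        (\<forall>m c. simple_cycle \<Gamma> H m c \<longrightarrow>
          (\<exists>j\<in>{1..m-1}.
             obs_bwd (proj_slice domf domV (c j)) (\<lambda>\<xi>. f (\<xi>, c j)) (W (c j)) \<inter>
             obs_fwd (proj_slice domf domV (c (j+1))) (\<lambda>\<xi>. f (\<xi>, c (j+1))) (W (c (j+1)))
             \<subseteq> {0})))
      \<longrightarrow> (x \<longlongrightarrow> 0) at_top)
     \<and>
     ((\<exists>(domV :: ((real ^ 'n) \<times> 'g) set) (V :: (real ^ 'n) \<times> 'g \<Rightarrow> real)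
        (W :: 'g \<Rightarrow> real ^ 'n \<Rightarrow> real).
        class_V \<Gamma> domf domV V \<and>
        continuous_on (domf \<inter> (proj_dom domV \<times> \<Gamma>)) V \<and>
        precompact_relative I x (proj_dom domV) \<and>
        antimono_on {0..} (\<lambda>t. V (x t, \<sigma> t)) \<and>
        dissipation \<Gamma> domf f domV V W \<and>
        0 \<in> proj_dom domV \<and>
        ((\<forall>\<gamma>\<in>\<Gamma>. obs_fwd_upto (proj_slice domf domV \<gamma>) (\<lambda>\<xi>. f (\<xi>, \<gamma>)) (W \<gamma>) \<infinity> \<subseteq> {0}) \<or>
         (\<forall>\<gamma>\<in>\<Gamma>. obs_bwd_upto (proj_slice domf domV \<gamma>) (\<lambda>\<xi>. f (\<xi>, \<gamma>)) (W \<gamma>) \<infinity> \<subseteq> {0})) \<and>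
        (\<forall>v m c. simple_cycle \<Gamma> H m c \<longrightarrow>
          (\<exists>j\<in>{1..m-1}.
             obs_bwd (proj_slice domf domV (c j)) (\<lambda>\<xi>. f (\<xi>, c j)) (W (c j)) \<inter>
             obs_fwd (proj_slice domf domV (c (j+1))) (\<lambda>\<xi>. f (\<xi>, c (j+1))) (W (c (j+1))) \<inter>
             {\<xi> \<in> slice domV (c j). V (\<xi>, c j) = v} \<inter>
             {\<xi> \<in> slice domV (c (j+1)). V (\<xi>, c (j+1)) = v}
             \<subseteq> {0})))
      \<longrightarrow> (x \<longlongrightarrow> 0) at_top)"
proof (intro conjI impI; elim exE conjE)
  fix domV :: "((real ^ 'n) \<times> 'g) set" and V :: "(real ^ 'n) \<times> 'g \<Rightarrow> real"
    and W :: "'g \<Rightarrow> real ^ 'n \<Rightarrow> real"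
  let ?v = "\<lambda>t. V (x t, \<sigma> t)"
  assume class_V: "class_V \<Gamma> domf domV V" and pre: "precompact_relative I x (proj_dom domV)"
    and mono: "\<forall>\<gamma>\<in>\<Gamma>. antimono_on (\<sigma> -` {\<gamma>} \<inter> {0..}) ?v"
    and dissip: "dissipation \<Gamma> domf f domV V W"
    and inv: "(\<forall>\<gamma>\<in>\<Gamma>. obs_fwd_upto (proj_slice domf domV \<gamma>) (\<lambda>\<xi>. f (\<xi>, \<gamma>)) (W \<gamma>) \<infinity> \<subseteq> {0}) \<or>
         (\<forall>\<gamma>\<in>\<Gamma>. obs_bwd_upto (proj_slice domf domV \<gamma>) (\<lambda>\<xi>. f (\<xi>, \<gamma>)) (W \<gamma>) \<infinity> \<subseteq> {0})"
    and cyc: "\<forall>m c. simple_cycle \<Gamma> H m c \<longrightarrow>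
          (\<exists>j\<in>{1..m-1}.
             obs_bwd (proj_slice domf domV (c j)) (\<lambda>\<xi>. f (\<xi>, c j)) (W (c j)) \<inter>
             obs_fwd (proj_slice domf domV (c (j+1))) (\<lambda>\<xi>. f (\<xi>, c (j+1))) (W (c (j+1)))
             \<subseteq> {0})"
  obtain B where B: "compact B" "B \<subseteq> proj_dom domV" "\<And>t. t \<in> I \<Longrightarrow> x t \<in> B"
    using pre by (auto simp: precompact_relative_def)
  interpret bounded_trajectory \<Gamma> domf f I x \<sigma> B
    using assms B by unfold_locales (auto simp: forward_complete_def)
  \<comment> \<open>One level per mode, since monotonicity is known only among times of equal mode.
    For a mode that does not occur after time 0 this is the infimum of the empty set, and the claim
    about it is vacuous.\<close>
  let ?C = "\<lambda>\<gamma>. Inf (?v ` (\<sigma> -` {\<gamma>} \<inter> {0..}))"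
  show "(x \<longlongrightarrow> 0) at_top"
  proof (rule tendsto_zero[OF assms(8) _ class_V B(2) dissip _ inv, of ?C])
    fix \<gamma> and \<epsilon> :: real assume \<gamma>: "\<gamma> \<in> \<Gamma>" and "\<epsilon> > 0"
    have "bdd_below (?v ` (\<sigma> -` {\<gamma>} \<inter> {0..}))"
      by (rule bdd_below_mono[OF V_bdd_below[OF class_V B(2)]]) auto
    from antimono_on_eventually_near_Inf[OF mono[rule_format, OF \<gamma>] this \<open>\<epsilon> > 0\<close>] eventually_ge_at_top[of 0]
    show "\<forall>\<^sub>F t in at_top. \<sigma> t = \<gamma> \<longrightarrow> \<bar>V (x t, \<gamma>) - ?C \<gamma>\<bar> < \<epsilon>"
      by eventually_elim auto
  next
    fix m c assume "simple_cycle \<Gamma> H m c"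
    then obtain j where "j \<in> {1..m-1}"
      "obs_bwd (proj_slice domf domV (c j)) (\<lambda>\<xi>. f (\<xi>, c j)) (W (c j)) \<inter>
       obs_fwd (proj_slice domf domV (c (j+1))) (\<lambda>\<xi>. f (\<xi>, c (j+1))) (W (c (j+1))) \<subseteq> {0}"
      using cyc by blast
    \<comment> \<open>Intersecting with the level sets only shrinks the set.\<close>
    then show "\<exists>j\<in>{1..m-1}.
        obs_bwd (proj_slice domf domV (c j)) (\<lambda>\<xi>. f (\<xi>, c j)) (W (c j)) \<inter>
        obs_fwd (proj_slice domf domV (c (j+1))) (\<lambda>\<xi>. f (\<xi>, c (j+1))) (W (c (j+1))) \<inter>
        {\<xi> \<in> slice domV (c j). V (\<xi>, c j) = ?C (c j)} \<inter>
        {\<xi> \<in> slice domV (c (j+1)). V (\<xi>, c (j+1)) = ?C (c (j+1))} \<subseteq> {0}"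
      by (intro bexI[of _ j]) blast
  qed (use assms(10) in blast)
next
  fix domV :: "((real ^ 'n) \<times> 'g) set" and V :: "(real ^ 'n) \<times> 'g \<Rightarrow> real"
    and W :: "'g \<Rightarrow> real ^ 'n \<Rightarrow> real"
  let ?v = "\<lambda>t. V (x t, \<sigma> t)"
  assume class_V: "class_V \<Gamma> domf domV V" and pre: "precompact_relative I x (proj_dom domV)"
    and mono: "antimono_on {0..} ?v"
    and dissip: "dissipation \<Gamma> domf f domV V W"
    and inv: "(\<forall>\<gamma>\<in>\<Gamma>. obs_fwd_upto (proj_slice domf domV \<gamma>) (\<lambda>\<xi>. f (\<xi>, \<gamma>)) (W \<gamma>) \<infinity> \<subseteq> {0}) \<or>
         (\<forall>\<gamma>\<in>\<Gamma>. obs_bwd_upto (proj_slice domf domV \<gamma>) (\<lambda>\<xi>. f (\<xi>, \<gamma>)) (W \<gamma>) \<infinity> \<subseteq> {0})"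
    and cyc: "\<forall>v m c. simple_cycle \<Gamma> H m c \<longrightarrow>
          (\<exists>j\<in>{1..m-1}.
             obs_bwd (proj_slice domf domV (c j)) (\<lambda>\<xi>. f (\<xi>, c j)) (W (c j)) \<inter>
             obs_fwd (proj_slice domf domV (c (j+1))) (\<lambda>\<xi>. f (\<xi>, c (j+1))) (W (c (j+1))) \<inter>
             {\<xi> \<in> slice domV (c j). V (\<xi>, c j) = v} \<inter>
             {\<xi> \<in> slice domV (c (j+1)). V (\<xi>, c (j+1)) = v}
             \<subseteq> {0})"
  obtain B where B: "compact B" "B \<subseteq> proj_dom domV" "\<And>t. t \<in> I \<Longrightarrow> x t \<in> B"
    using pre by (auto simp: precompact_relative_def)
  interpret bounded_trajectory \<Gamma> domf f I x \<sigma> B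
    using assms B by unfold_locales (auto simp: forward_complete_def)
  show "(x \<longlongrightarrow> 0) at_top"
  \<comment> \<open>Here monotonicity holds across the switches, so one infimum is the level of
    every mode, and (iii) is applied with this number as the constant.\<close>
  proof (rule tendsto_zero[OF assms(8) _ class_V B(2) dissip _ inv, of "\<lambda>_. Inf (?v ` {0..})"])
    fix \<gamma> and \<epsilon> :: real assume "\<epsilon> > 0"
    from antimono_on_eventually_near_Inf[OF mono V_bdd_below[OF class_V B(2)] this] eventually_ge_at_top[of 0]
    show "\<forall>\<^sub>F t in at_top. \<sigma> t = \<gamma> \<longrightarrow> \<bar>V (x t, \<gamma>) - Inf (?v ` {0..})\<bar> < \<epsilon>"
      by eventually_elim auto
  qed (use assms(10) cyc in blast)+
qed

end
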